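(* Let $(B^{n},g_{B})$ and $(F^{d},g_{F})$, with $n\geq 3$, be Einstein manifolds whose Ricci curvatures are constant and equal to $\lambda_{B}$ and $\lambda_{F}$, respectively. Then the warped product manifold $M=B\times_{f}F$, with $f$ non-constant, is an Einstein manifold with constant Ricci curvature $\lambda$ if and only if the following conditions (i), (ii), (iii) and (iv) are satisfied: \begin{itemize} \item[(i)] $\mathrm{Hess}_{g_{B}}f(X,Y)=\dfrac{f}{d}(\lambda_{B}-\lambda)\,g_{B}(X,Y)$ for all vector fields $X,Y$ on $B$ (lifted to $M$); \item[(ii)] $\lambda=\left(1+\dfrac{d}{n-1}\right)\lambda_{B}$; \item[(iii)] the function $f$ satisfies $\|\nabla f\|^{2}=-\rho f^{2}+c$, where $c$ is a constant and $\rho$ is the normalized scalar curvature of $B$; \item[(iv)] $\lambda_{F}=(d-1)c$, with $c$ the constant of (iii). \end{itemize}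
   Context: A semi-Riemannian manifold $(N,h)$ is Einstein with constant Ricci curvature $\mu\in\mathbb{R}$ if $\mathrm{Ric}_h=\mu h$. For semi-Riemannian manifolds $(B^n,g_B)$, $(F^d,g_F)$ of dimensions $n$, $d$ and a smooth function $f>0$ on $B$, the warped product $B\times_f F$ is the product manifold $B\times F$ with the metric $g_B+f^2g_F$ (pullbacks under the projections understood); $B$ is the base, $F$ the fiber and $f$ the warping function. When $d=1$, $\lambda_F=0$. $\mathrm{Hess}_{g_B}f$ and $\nabla f$ are the Hessian and gradient with respect to $g_B$, and $\|\nabla f\|^2=g_B(\nabla f,\nabla f)$. The normalized scalar curvature of $B^n$ is its scalar curvature divided by $n(n-1)$; for $B$ Einstein, $\rho=\lambda_B/(n-1)$.
   Formalization: The base B is assumed connected, which the text leaves implicit; without this the claim fails for d = 1, since the constant c in (iii) may differ between components (two flat half-spaces with f = x and f = 2x). *)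

theory Defs
  imports "HOL-Analysis.Analysis"
begin

section \<open>Smooth functions between Euclidean spaces\<close>

abbreviation dir_deriv :: "('a::real_normed_vector \<Rightarrow> 'b::real_normed_vector) \<Rightarrow> 'a \<Rightarrow> 'a \<Rightarrow> 'b"
  where "dir_deriv h x v \<equiv> frechet_derivative h (at x) v"

text \<open>For open \<open>S\<close> in finite dimension this is the usual \<open>C\<^sup>k\<close>: the map is differentiable
  and all its directional derivatives are \<open>C\<^sup>k\<^sup>-\<^sup>1\<close>.\<close>

primrec Ck_on :: "nat \<Rightarrow> 'a::real_normed_vector set \<Rightarrow> ('a \<Rightarrow> 'b::real_normed_vector) \<Rightarrow> bool" where
  "Ck_on 0 S h \<longleftrightarrow> continuous_on S h"
| "Ck_on (Suc k) S h \<longleftrightarrow> (\<forall>x\<in>S. h differentiable (at x)) \<and> (\<forall>v. Ck_on k S (\<lambda>x. dir_deriv h x v))"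

definition smooth_on :: "'a::real_normed_vector set \<Rightarrow> ('a \<Rightarrow> 'b::real_normed_vector) \<Rightarrow> bool"
  where "smooth_on S h \<longleftrightarrow> (\<forall>k. Ck_on k S h)"

section \<open>Manifolds\<close>

text \<open>The points of a manifold form a whole type; the Hausdorff property and second countability
  are imposed as type classes. The dimension is that of the Euclidean model space \<open>'a\<close>. The second
  component of a chart is total, but only its values on the first component (the domain) matter.\<close>

type_synonym ('p, 'a) chart = "'p set \<times> ('p \<Rightarrow> 'a)"

definition chart_inv :: "('p, 'a) chart \<Rightarrow> 'a \<Rightarrow> 'p"
  where "chart_inv c = inv_into (fst c) (snd c)"

definition is_chart :: "('p::topological_space, 'a::euclidean_space) chart \<Rightarrow> bool" where
  "is_chart c \<longleftrightarrow> open (fst c) \<and> open (snd c ` fst c) \<and>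
     homeomorphism (fst c) (snd c ` fst c) (snd c) (chart_inv c)"

definition smooth_atlas :: "('p::{t2_space, second_countable_topology}, 'a::euclidean_space) chart set \<Rightarrow> bool"
  where
  "smooth_atlas A \<longleftrightarrow> (\<forall>c\<in>A. is_chart c) \<and> (\<Union>c\<in>A. fst c) = UNIV \<and>
     (\<forall>c\<in>A. \<forall>c'\<in>A. smooth_on (snd c ` (fst c \<inter> fst c')) (snd c' \<circ> chart_inv c))"

definition charts_at :: "('p, 'a) chart set \<Rightarrow> 'p \<Rightarrow> ('p, 'a) chart set"
  where "charts_at A p = {c \<in> A. p \<in> fst c}"

definition smooth_fun_on ::
  "('p::topological_space, 'a::euclidean_space) chart set \<Rightarrow> 'p set \<Rightarrow> ('p \<Rightarrow> real) \<Rightarrow> bool" where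
  "smooth_fun_on A W h \<longleftrightarrow> (\<forall>c\<in>A. smooth_on (snd c ` (fst c \<inter> W)) (h \<circ> chart_inv c))"

definition smooth_near ::
  "('p::topological_space, 'a::euclidean_space) chart set \<Rightarrow> 'p \<Rightarrow> ('p \<Rightarrow> real) \<Rightarrow> bool" where
  "smooth_near A p h \<longleftrightarrow> (\<exists>W. open W \<and> p \<in> W \<and> smooth_fun_on A W h)"

section \<open>Tangent vectors\<close>

text \<open>A tangent vector at \<open>p\<close> is a directional derivative acting on the functions that are smooth
  near \<open>p\<close>; it is extended by \<open>0\<close> to all other functions, so that it is determined by its
  action on smooth ones. \<open>coord_vector A c p u\<close> is the vector with components \<open>u\<close> in the
  chart \<open>c\<close>.\<close>

type_synonym 'p tangent = "('p \<Rightarrow> real) \<Rightarrow> real"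

definition coord_vector ::
  "('p::topological_space, 'a::euclidean_space) chart set \<Rightarrow> ('p, 'a) chart \<Rightarrow> 'p \<Rightarrow> 'a \<Rightarrow> 'p tangent" where
  "coord_vector A c p u =
     (\<lambda>h. if smooth_near A p h then dir_deriv (h \<circ> chart_inv c) (snd c p) u else 0)"

definition tangent_space ::
  "('p::topological_space, 'a::euclidean_space) chart set \<Rightarrow> 'p \<Rightarrow> 'p tangent set" where
  "tangent_space A p = {coord_vector A c p u | c u. c \<in> charts_at A p}"

definition components ::
  "('p::topological_space, 'a::euclidean_space) chart set \<Rightarrow> ('p, 'a) chart \<Rightarrow> 'p \<Rightarrow> 'p tangent \<Rightarrow> 'a" where
  "components A c p X = (THE u. X = coord_vector A c p u)"

definition tangent_map :: "('p \<Rightarrow> 'q) \<Rightarrow> 'p tangent \<Rightarrow> 'q tangent"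
  where "tangent_map \<pi> X = (\<lambda>h. X (h \<circ> \<pi>))"

section \<open>Semi-Riemannian metrics\<close>

text \<open>Only the values of \<open>g p\<close> on \<open>tangent_space A p\<close> matter.\<close>

type_synonym 'p metric = "'p \<Rightarrow> 'p tangent \<Rightarrow> 'p tangent \<Rightarrow> real"

definition local_metric ::
  "('p::topological_space, 'a::euclidean_space) chart set \<Rightarrow> 'p metric \<Rightarrow> ('p, 'a) chart
     \<Rightarrow> 'a \<Rightarrow> 'a \<Rightarrow> 'a \<Rightarrow> real" where
  "local_metric A g c x u v =
     g (chart_inv c x) (coord_vector A c (chart_inv c x) u) (coord_vector A c (chart_inv c x) v)"

definition form_index :: "('a::euclidean_space \<Rightarrow> 'a \<Rightarrow> real) \<Rightarrow> nat" where
  "form_index b = Max {dim S | S. subspace S \<and> (\<forall>u\<in>S. u \<noteq> 0 \<longrightarrow> b u u < 0)}"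

definition scalar_product :: "('a::euclidean_space \<Rightarrow> 'a \<Rightarrow> real) \<Rightarrow> bool" where
  "scalar_product b \<longleftrightarrow> bilinear b \<and> (\<forall>u v. b u v = b v u) \<and> (\<forall>u. (\<forall>v. b u v = 0) \<longrightarrow> u = 0)"

definition semi_riemannian ::
  "('p::{t2_space, second_countable_topology}, 'a::euclidean_space) chart set \<Rightarrow> 'p metric \<Rightarrow> bool" where
  "semi_riemannian A g \<longleftrightarrow> smooth_atlas A \<and>
     (\<forall>c\<in>A. \<forall>u v. smooth_on (snd c ` fst c) (\<lambda>x. local_metric A g c x u v)) \<and>
     (\<forall>c\<in>A. \<forall>x\<in>snd c ` fst c. scalar_product (local_metric A g c x)) \<and>
     (\<exists>\<nu>. \<forall>c\<in>A. \<forall>x\<in>snd c ` fst c. form_index (local_metric A g c x) = \<nu>)"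

section \<open>Curvature, Hessian and gradient\<close>

text \<open>\<open>sharp b \<alpha>\<close> is the vector representing the covector \<open>\<alpha>\<close> with respect to \<open>b\<close>.\<close>

definition sharp :: "('a \<Rightarrow> 'a \<Rightarrow> real) \<Rightarrow> ('a \<Rightarrow> real) \<Rightarrow> 'a"
  where "sharp b \<alpha> = (THE w. \<forall>z. b w z = \<alpha> z)"

text \<open>The following functions live on the image of a chart; \<open>G\<close> stands for the local expression
  of the metric. \<open>christoffel G x u v\<close> is the value at \<open>x\<close> of the Levi-Civita derivative
  \<open>\<nabla>\<^sub>u v\<close> of the constant fields \<open>u\<close>, \<open>v\<close>, given by the Koszul formula. The sign of the
  curvature is \<open>R(u,v)w = \<nabla>\<^sub>u\<nabla>\<^sub>v w - \<nabla>\<^sub>v\<nabla>\<^sub>u w\<close> (again for constant fields) and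
  \<open>Ric(v,w)\<close> is the trace of \<open>u \<mapsto> R(u,v)w\<close>, so that round spheres have positive Ricci
  curvature. The sums over \<open>Basis\<close> are traces of endomorphisms and use no metric on the model
  space.\<close>

definition christoffel :: "('a::euclidean_space \<Rightarrow> 'a \<Rightarrow> 'a \<Rightarrow> real) \<Rightarrow> 'a \<Rightarrow> 'a \<Rightarrow> 'a \<Rightarrow> 'a" where
  "christoffel G x u v = sharp (G x)
     (\<lambda>z. (dir_deriv (\<lambda>y. G y v z) x u + dir_deriv (\<lambda>y. G y u z) x v - dir_deriv (\<lambda>y. G y u v) x z) / 2)"

definition local_curvature ::
  "('a::euclidean_space \<Rightarrow> 'a \<Rightarrow> 'a \<Rightarrow> real) \<Rightarrow> 'a \<Rightarrow> 'a \<Rightarrow> 'a \<Rightarrow> 'a \<Rightarrow> 'a" where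
  "local_curvature G x u v w =
     dir_deriv (\<lambda>y. christoffel G y v w) x u + christoffel G x u (christoffel G x v w)
     - dir_deriv (\<lambda>y. christoffel G y u w) x v - christoffel G x v (christoffel G x u w)"

definition local_ricci :: "('a::euclidean_space \<Rightarrow> 'a \<Rightarrow> 'a \<Rightarrow> real) \<Rightarrow> 'a \<Rightarrow> 'a \<Rightarrow> 'a \<Rightarrow> real" where
  "local_ricci G x v w = (\<Sum>b\<in>Basis. local_curvature G x b v w \<bullet> b)"

definition local_scalar_curvature :: "('a::euclidean_space \<Rightarrow> 'a \<Rightarrow> 'a \<Rightarrow> real) \<Rightarrow> 'a \<Rightarrow> real" where
  "local_scalar_curvature G x = (\<Sum>b\<in>Basis. sharp (G x) (local_ricci G x b) \<bullet> b)"

definition local_hessian ::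
  "('a::euclidean_space \<Rightarrow> 'a \<Rightarrow> 'a \<Rightarrow> real) \<Rightarrow> ('a \<Rightarrow> real) \<Rightarrow> 'a \<Rightarrow> 'a \<Rightarrow> 'a \<Rightarrow> real" where
  "local_hessian G h x u v =
     dir_deriv (\<lambda>y. dir_deriv h y v) x u - dir_deriv h x (christoffel G x u v)"

text \<open>The corresponding objects on the manifold, computed at the point \<open>p\<close> in a chart
  \<open>c \<in> charts_at A p\<close>. Their values do not depend on the chart; statements about them are
  made for every chart around the point.\<close>

definition ricci ::
  "('p::topological_space, 'a::euclidean_space) chart set \<Rightarrow> 'p metric \<Rightarrow> ('p, 'a) chart
     \<Rightarrow> 'p \<Rightarrow> 'p tangent \<Rightarrow> 'p tangent \<Rightarrow> real" where
  "ricci A g c p X Y =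
     local_ricci (local_metric A g c) (snd c p) (components A c p X) (components A c p Y)"

definition scalar_curvature ::
  "('p::topological_space, 'a::euclidean_space) chart set \<Rightarrow> 'p metric \<Rightarrow> ('p, 'a) chart \<Rightarrow> 'p \<Rightarrow> real" where
  "scalar_curvature A g c p = local_scalar_curvature (local_metric A g c) (snd c p)"

definition normalized_scalar_curvature ::
  "('p::topological_space, 'a::euclidean_space) chart set \<Rightarrow> 'p metric \<Rightarrow> ('p, 'a) chart \<Rightarrow> 'p \<Rightarrow> real" where
  "normalized_scalar_curvature A g c p =
     scalar_curvature A g c p / (real DIM('a) * (real DIM('a) - 1))"

definition hessian ::
  "('p::topological_space, 'a::euclidean_space) chart set \<Rightarrow> 'p metric \<Rightarrow> ('p \<Rightarrow> real)
     \<Rightarrow> ('p, 'a) chart \<Rightarrow> 'p \<Rightarrow> 'p tangent \<Rightarrow> 'p tangent \<Rightarrow> real" where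
  "hessian A g f c p X Y =
     local_hessian (local_metric A g c) (f \<circ> chart_inv c) (snd c p)
       (components A c p X) (components A c p Y)"

definition gradient ::
  "('p::topological_space, 'a::euclidean_space) chart set \<Rightarrow> 'p metric \<Rightarrow> ('p \<Rightarrow> real) \<Rightarrow> 'p \<Rightarrow> 'p tangent" where
  "gradient A g f p = (THE X. X \<in> tangent_space A p \<and> (\<forall>Y\<in>tangent_space A p. g p X Y = Y f))"

definition einstein ::
  "('p::{t2_space, second_countable_topology}, 'a::euclidean_space) chart set \<Rightarrow> 'p metric \<Rightarrow> real \<Rightarrow> bool"
  where
  "einstein A g \<mu> \<longleftrightarrow> semi_riemannian A g \<and>
     (\<forall>p. \<forall>c\<in>charts_at A p. \<forall>X\<in>tangent_space A p. \<forall>Y\<in>tangent_space A p.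
        ricci A g c p X Y = \<mu> * g p X Y)"

section \<open>Warped products\<close>

definition product_chart :: "('p, 'a) chart \<Rightarrow> ('q, 'b) chart \<Rightarrow> ('p \<times> 'q, 'a \<times> 'b) chart"
  where "product_chart c c' = (fst c \<times> fst c', map_prod (snd c) (snd c'))"

definition product_atlas ::
  "('p, 'a) chart set \<Rightarrow> ('q, 'b) chart set \<Rightarrow> ('p \<times> 'q, 'a \<times> 'b) chart set" where
  "product_atlas A A' = {product_chart c c' | c c'. c \<in> A \<and> c' \<in> A'}"

definition warped_metric :: "'p metric \<Rightarrow> ('p \<Rightarrow> real) \<Rightarrow> 'q metric \<Rightarrow> ('p \<times> 'q) metric" where
  "warped_metric gB f gF = (\<lambda>m X Y.
     gB (fst m) (tangent_map fst X) (tangent_map fst Y)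
     + (f (fst m))\<^sup>2 * gF (snd m) (tangent_map snd X) (tangent_map snd Y))"

end

theory Submission
  imports Defs
begin

text \<open>In product charts, the Christoffel symbols of \<open>g\<^sub>B + f\<^sup>2 g\<^sub>F\<close> are those of the factors plus terms in
  \<open>df / f\<close> and \<open>f \<nabla>f\<close>. Taking the trace of the curvature gives
  \<open>Ric = Ric\<^sub>B + Ric\<^sub>F - (d / f) Hess f - (f \<Delta>f + (d - 1) \<parallel>\<nabla>f\<parallel>\<^sup>2) g\<^sub>F\<close>, so \<open>M\<close> is Einstein with constant \<open>\<lambda>\<close> iff
  \<open>Hess f = k f g\<^sub>B\<close> with \<open>k = (\<lambda>\<^sub>B - \<lambda>) / d\<close> and \<open>\<lambda>\<^sub>F = (\<lambda> + n k) f\<^sup>2 + (d - 1) \<parallel>\<nabla>f\<parallel>\<^sup>2\<close>.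
  The Hessian equation says \<open>\<nabla>\<^sub>X \<nabla>f = k f X\<close>; it makes \<open>\<parallel>\<nabla>f\<parallel>\<^sup>2 - k f\<^sup>2\<close> constant on the connected base, and
  commuting covariant derivatives gives \<open>R(X, Y) \<nabla>f = k (df(X) Y - df(Y) X)\<close>, whose trace is
  \<open>\<lambda>\<^sub>B df = - (n - 1) k df\<close>. As \<open>f\<close> is not constant, \<open>k = - \<lambda>\<^sub>B / (n - 1) = - \<rho>\<close>; the rest is algebra.\<close>

section \<open>Calculus of smooth functions\<close>

text \<open>The obstacle is regularity. \<open>christoffel\<close> is defined through
  \<open>sharp\<close>, a definite description, while curvature differentiates it once more.
  Smoothness is therefore extracted from the defining equation of \<open>sharp\<close>: the vectors
  dual to the coordinate functionals solve a linear system close to the identity.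
  \<open>einstein\<close> and the Hessian condition are imposed in every chart around a point, and
  \<open>product_atlas\<close> consists of product charts, so everything can be checked chart by
  chart. The algebra at the end rests on one coefficient. With \<open>lam = lamB - d * k\<close>,
  inserting |grad f|^2 = k f^2 + c into the fiber equation gives \<open>lamF\<close> =
  (\<open>lamB\<close> + (n - 1) k) f^2 + (d - 1) c. The trace identity says exactly that the
  bracket vanishes, which leaves (iv). Conversely, (ii) is the trace identity rewritten, so in that
  direction (ii) itself supplies the vanishing.\<close>

lemma has_derivative_dir_deriv:
  "h differentiable (at x) \<Longrightarrow> (h has_derivative dir_deriv h x) (at x)"
  by (simp add: frechet_derivative_works)

lemma dir_deriv_eqI: "(h has_derivative D) (at x) \<Longrightarrow> dir_deriv h x v = D v"
  by (metis frechet_derivative_at)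

lemma differentiable_cong_open:
  assumes "open S" "\<And>x. x \<in> S \<Longrightarrow> h x = h' x" "x \<in> S" "h differentiable (at x)"
  shows "h' differentiable (at x)"
  using assms has_derivative_transform_within_open unfolding differentiable_def by blast

lemma dir_deriv_cong_open:
  assumes "open S" "\<And>x. x \<in> S \<Longrightarrow> h x = h' x" "x \<in> S"
  shows "dir_deriv h x = dir_deriv h' x"
proof -
  have "(h has_derivative D) (at x) \<longleftrightarrow> (h' has_derivative D) (at x)" for D
    using has_derivative_transform_within_open[OF _ assms(1,3), of h D UNIV h'] 
      has_derivative_transform_within_open[OF _ assms(1,3), of h' D UNIV h] assms(2) by force
  then show ?thesis by (simp add: frechet_derivative_def)
qed

text \<open>On an open set agreement of two functions passes to their derivatives. This matters
  throughout: chart inverses, dual bases and warped Christoffel symbols are given by usable formulas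
  only inside an open set and are arbitrary elsewhere.\<close>

lemma Ck_on_cong:
  assumes "open S" "\<And>x. x \<in> S \<Longrightarrow> h x = h' x" "Ck_on k S h"
  shows "Ck_on k S h'"
  using assms(2,3)
proof (induction k arbitrary: h h')
  case 0
  then show ?case using continuous_on_cong by simp
next
  case (Suc k)
  have "Ck_on k S (\<lambda>x. dir_deriv h' x v)" for v
    using Suc.IH[of "\<lambda>x. dir_deriv h x v"] Suc.prems dir_deriv_cong_open[OF assms(1) Suc.prems(1)]
    by simp
  then show ?case using Suc.prems differentiable_cong_open[OF assms(1) Suc.prems(1)] by simp
qed

lemma Ck_on_SucD: "Ck_on (Suc k) S h \<Longrightarrow> Ck_on k S h"
proof (induction k arbitrary: h)
  case 0
  then show ?case
    by (auto intro!: continuous_at_imp_continuous_on differentiable_imp_continuous_within)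
qed simp

lemma Ck_on_const: "Ck_on k S (\<lambda>x. c)"
  by (induction k arbitrary: c) simp_all

lemma Ck_on_add:
  assumes "open S" "Ck_on k S h" "Ck_on k S h'"
  shows "Ck_on k S (\<lambda>x. h x + h' x)"
  using assms(2,3)
proof (induction k arbitrary: h h')
  case 0
  then show ?case by (auto intro: continuous_intros)
next
  case (Suc k)
  have *: "dir_deriv h x v + dir_deriv h' x v = dir_deriv (\<lambda>x. h x + h' x) x v" if "x \<in> S" for x v
    using Suc.prems that
    by (intro dir_deriv_eqI[symmetric] has_derivative_add has_derivative_dir_deriv) auto
  have "Ck_on k S (\<lambda>x. dir_deriv (\<lambda>x. h x + h' x) x v)" for v
    by (rule Ck_on_cong[OF assms(1) *], assumption, rule Suc.IH) (use Suc.prems in auto)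
  then show ?case using Suc.prems by simp
qed

lemma Ck_on_sum:
  assumes "open S" "\<And>i. i \<in> I \<Longrightarrow> Ck_on k S (h i)"
  shows "Ck_on k S (\<lambda>x. \<Sum>i\<in>I. h i x)"
  using assms(2)
proof (induction I rule: infinite_finite_induct)
  case (insert i I)
  then show ?case by (simp, intro Ck_on_add[OF assms(1)]) auto
qed (auto simp: Ck_on_const)

lemma Ck_on_bounded_linear:
  assumes "open S" "bounded_linear L" "Ck_on k S h"
  shows "Ck_on k S (\<lambda>x. L (h x))"
  using assms(3)
proof (induction k arbitrary: h)
  case 0
  then show ?case using assms(2) bounded_linear.continuous_on by auto
next
  case (Suc k)
  have d: "((\<lambda>x. L (h x)) has_derivative (\<lambda>v. L (dir_deriv h x v))) (at x)" if "x \<in> S" for x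
    using Suc.prems that
    by (intro bounded_linear.has_derivative[OF assms(2)] has_derivative_dir_deriv) auto
  have "Ck_on k S (\<lambda>x. dir_deriv (\<lambda>x. L (h x)) x v)" for v
    by (rule Ck_on_cong[OF assms(1) dir_deriv_eqI[OF d, symmetric]], assumption, rule Suc.IH)
      (use Suc.prems in auto)
  then show ?case using d by (auto simp: differentiable_def)
qed

text \<open>The product rule pairs the derivative of one factor with the other factor itself. The
  latter is one order too regular for the induction hypothesis and is lowered by
  \<open>Ck_on_SucD\<close>.\<close>

lemma Ck_on_bounded_bilinear:
  assumes "open S" "bounded_bilinear P" "Ck_on k S h" "Ck_on k S h'"
  shows "Ck_on k S (\<lambda>x. P (h x) (h' x))"
  using assms(3,4)
proof (induction k arbitrary: h h')
  case 0
  then show ?case using assms(2) bounded_bilinear.continuous_on by auto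
next
  case (Suc k)
  have d: "((\<lambda>x. P (h x) (h' x)) has_derivative
      (\<lambda>v. P (h x) (dir_deriv h' x v) + P (dir_deriv h x v) (h' x))) (at x)" if "x \<in> S" for x
    using Suc.prems that
    by (intro bounded_bilinear.FDERIV[OF assms(2)] has_derivative_dir_deriv) auto
  have "Ck_on k S (\<lambda>x. dir_deriv (\<lambda>x. P (h x) (h' x)) x v)" for v
    by (rule Ck_on_cong[OF assms(1) dir_deriv_eqI[OF d, symmetric]], assumption,
        rule Ck_on_add[OF assms(1)]; rule Suc.IH) (use Suc.prems Ck_on_SucD in auto)
  then show ?case using d by (auto simp: differentiable_def)
qed

text \<open>For an affine inner map the chain rule differentiates \<open>h\<close> in the fixed
  direction \<open>L v\<close>, so the induction stays within the directional derivatives of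
  \<open>Ck_on\<close>. Projections and slices of product charts are of this kind.\<close>

lemma Ck_on_affine_compose:
  assumes "open T" "bounded_linear L" "\<And>x. x \<in> T \<Longrightarrow> L x + y0 \<in> S" "Ck_on k S h"
  shows "Ck_on k T (\<lambda>x. h (L x + y0))"
  using assms(4)
proof (induction k arbitrary: h)
  case 0
  have "continuous_on T (\<lambda>x. L x + y0)"
    using assms(2) by (intro continuous_intros linear_continuous_on)
  then show ?case using 0 assms(3) by (auto intro!: continuous_on_compose2[of S h T])
next
  case (Suc k)
  have d: "((\<lambda>x. h (L x + y0)) has_derivative (\<lambda>v. dir_deriv h (L x + y0) (L v))) (at x)"
    if "x \<in> T" for x
  proof -
    have "((\<lambda>x. L x + y0) has_derivative L) (at x)"
      using bounded_linear_imp_has_derivative[OF assms(2)] has_derivative_add_const by blast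
    moreover have "(h has_derivative dir_deriv h (L x + y0)) (at (L x + y0))"
      using Suc.prems that assms(3) has_derivative_dir_deriv by auto
    ultimately show ?thesis using diff_chain_at by (fastforce simp: o_def)
  qed
  have "Ck_on k T (\<lambda>x. dir_deriv (\<lambda>x. h (L x + y0)) x v)" for v
    by (rule Ck_on_cong[OF assms(1) dir_deriv_eqI[OF d, symmetric]], assumption, rule Suc.IH)
      (use Suc.prems in auto)
  then show ?case using d by (auto simp: differentiable_def)
qed

lemma smooth_on_cong:
  "open S \<Longrightarrow> (\<And>x. x \<in> S \<Longrightarrow> h x = h' x) \<Longrightarrow> smooth_on S h \<Longrightarrow> smooth_on S h'"
  unfolding smooth_on_def using Ck_on_cong by blast

lemma smooth_on_add:
  "open S \<Longrightarrow> smooth_on S h \<Longrightarrow> smooth_on S h' \<Longrightarrow> smooth_on S (\<lambda>x. h x + h' x)"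
  by (simp add: smooth_on_def Ck_on_add)

lemma smooth_on_bounded_linear:
  "open S \<Longrightarrow> bounded_linear L \<Longrightarrow> smooth_on S h \<Longrightarrow> smooth_on S (\<lambda>x. L (h x))"
  by (simp add: smooth_on_def Ck_on_bounded_linear)

lemma smooth_on_bounded_bilinear:
  "open S \<Longrightarrow> bounded_bilinear P \<Longrightarrow> smooth_on S h \<Longrightarrow> smooth_on S h' \<Longrightarrow>
    smooth_on S (\<lambda>x. P (h x) (h' x))"
  by (simp add: smooth_on_def Ck_on_bounded_bilinear)

lemma smooth_on_mult:
  fixes h h' :: "'a::real_normed_vector \<Rightarrow> real"
  shows "open S \<Longrightarrow> smooth_on S h \<Longrightarrow> smooth_on S h' \<Longrightarrow> smooth_on S (\<lambda>x. h x * h' x)"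
  by (rule smooth_on_bounded_bilinear[OF _ bounded_bilinear_mult])

lemma smooth_on_affine_compose:
  assumes "open T" "bounded_linear L" "\<And>x. x \<in> T \<Longrightarrow> L x + y0 \<in> S" "smooth_on S h"
  shows "smooth_on T (\<lambda>x. h (L x + y0))"
  using assms(4) Ck_on_affine_compose[OF assms(1-3)] unfolding smooth_on_def by blast

lemma smooth_on_dir_deriv: "smooth_on S h \<Longrightarrow> smooth_on S (\<lambda>x. dir_deriv h x v)"
  unfolding smooth_on_def by (metis Ck_on.simps(2))

lemma smooth_on_differentiable: "smooth_on S h \<Longrightarrow> x \<in> S \<Longrightarrow> h differentiable (at x)"
  unfolding smooth_on_def by (metis Ck_on.simps(2))

lemma smooth_on_has_derivative:
  "smooth_on S h \<Longrightarrow> x \<in> S \<Longrightarrow> (h has_derivative dir_deriv h x) (at x)"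
  by (intro has_derivative_dir_deriv smooth_on_differentiable)

lemma smooth_on_sum:
  "open S \<Longrightarrow> (\<And>i. i \<in> I \<Longrightarrow> smooth_on S (h i)) \<Longrightarrow> smooth_on S (\<lambda>x. \<Sum>i\<in>I. h i x)"
  by (simp add: smooth_on_def Ck_on_sum)

section \<open>Symmetry of second directional derivatives\<close>

lemma second_difference_mean_value:
  fixes h :: "'a::real_normed_vector \<Rightarrow> real"
  assumes "t > 0"
    and h: "\<And>a b. 0 \<le> a \<Longrightarrow> a \<le> t \<Longrightarrow> 0 \<le> b \<Longrightarrow> b \<le> t \<Longrightarrow>
      h differentiable (at (x + a *\<^sub>R u + b *\<^sub>R v)) \<and>
      (\<lambda>y. dir_deriv h y u) differentiable (at (x + a *\<^sub>R u + b *\<^sub>R v))"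
  obtains a b where "0 \<le> a" "a \<le> t" "0 \<le> b" "b \<le> t"
    "h (x + t *\<^sub>R u + t *\<^sub>R v) - h (x + t *\<^sub>R u) - h (x + t *\<^sub>R v) + h x
      = t * t * dir_deriv (\<lambda>y. dir_deriv h y u) (x + a *\<^sub>R u + b *\<^sub>R v) v"
proof -
  have line: "((\<lambda>s. k (p + s *\<^sub>R w + q)) has_real_derivative dir_deriv k (p + s *\<^sub>R w + q) w) (at s)"
    if "k differentiable (at (p + s *\<^sub>R w + q))" for k :: "'a \<Rightarrow> real" and p q w s
  proof -
    have "((\<lambda>s. p + s *\<^sub>R w + q) has_derivative (\<lambda>s. s *\<^sub>R w)) (at s)"
      by (auto intro!: derivative_eq_intros)
    from diff_chain_at[OF this has_derivative_dir_deriv[OF that]]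
    have "((\<lambda>s. k (p + s *\<^sub>R w + q)) has_derivative (\<lambda>r. dir_deriv k (p + s *\<^sub>R w + q) (r *\<^sub>R w))) (at s)"
      by (simp add: o_def)
    moreover have "linear (dir_deriv k (p + s *\<^sub>R w + q))"
      using that by (simp add: linear_frechet_derivative)
    ultimately show ?thesis
      by (simp add: has_field_derivative_def linear_cmul mult_commute_abs)
  qed
  \<comment> \<open>The second difference is \<open>p t - p 0\<close>; the mean value theorem is
    applied once along \<open>u\<close> and then along \<open>v\<close>. The summand
    \<open>0 *\<^sub>R v\<close> makes both terms of \<open>p\<close> instances of
    \<open>line\<close>.\<close>
  define p where "p s = h (x + s *\<^sub>R u + t *\<^sub>R v) - h (x + s *\<^sub>R u + 0 *\<^sub>R v)" for s
  have "(p has_real_derivative dir_deriv h (x + s *\<^sub>R u + t *\<^sub>R v) u - dir_deriv h (x + s *\<^sub>R u + 0 *\<^sub>R v) u) (at s)"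
    if "0 \<le> s" "s \<le> t" for s
    unfolding p_def using h[OF that, of t] h[OF that, of 0] \<open>t > 0\<close>
    by (intro DERIV_diff line) auto
  from MVT2[of 0 t p, OF \<open>t > 0\<close> this] obtain a where a: "0 < a" "a < t"
    "p t - p 0 = t * (dir_deriv h (x + a *\<^sub>R u + t *\<^sub>R v) u - dir_deriv h (x + a *\<^sub>R u + 0 *\<^sub>R v) u)"
    by auto
  \<comment> \<open>The trailing \<open>+ 0\<close> again only fits the shape required by
    \<open>line\<close>.\<close>
  define q where "q s = dir_deriv h (x + a *\<^sub>R u + s *\<^sub>R v + 0) u" for s
  have "(q has_real_derivative dir_deriv (\<lambda>y. dir_deriv h y u) (x + a *\<^sub>R u + s *\<^sub>R v + 0) v) (at s)"
    if "0 \<le> s" "s \<le> t" for s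
    unfolding q_def using h[of a s] that a by (intro line) auto
  from MVT2[of 0 t q, OF \<open>t > 0\<close> this] obtain b where b: "0 < b" "b < t"
    "q t - q 0 = t * dir_deriv (\<lambda>y. dir_deriv h y u) (x + a *\<^sub>R u + b *\<^sub>R v) v"
    by auto
  have "p t - p 0 = t * (t * dir_deriv (\<lambda>y. dir_deriv h y u) (x + a *\<^sub>R u + b *\<^sub>R v) v)"
    using a(3) b(3) by (simp add: q_def)
  then show ?thesis using that[of a b] a b by (simp add: p_def algebra_simps)
qed

text \<open>The second difference over a small parallelogram is symmetric in \<open>u\<close> and
  \<open>v\<close>. Evaluated in both orders it forces the two mixed derivatives to agree at two
  points close to \<open>x\<close>; continuity then rules out a gap at \<open>x\<close>.\<close>

lemma dir_deriv_commute:
  fixes h :: "'a::real_normed_vector \<Rightarrow> real"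
  assumes "open S" "x \<in> S" "smooth_on S h"
  shows "dir_deriv (\<lambda>y. dir_deriv h y u) x v = dir_deriv (\<lambda>y. dir_deriv h y v) x u"
proof (rule ccontr)
  define A where "A y = dir_deriv (\<lambda>y. dir_deriv h y u) y v" for y
  define B where "B y = dir_deriv (\<lambda>y. dir_deriv h y v) y u" for y
  assume "\<not> ?thesis"
  then have ne: "A x \<noteq> B x" by (simp add: A_def B_def)
  \<comment> \<open>Half the gap: two errors below \<open>e\<close> cannot bridge the distance from
    \<open>A x\<close> to \<open>B x\<close>.\<close>
  define e where "e = \<bar>A x - B x\<bar> / 2"
  have "e > 0" using ne by (simp add: e_def)
  have "continuous (at x) A" "continuous (at x) B"
    using assms smooth_on_dir_deriv smooth_on_differentiable differentiable_imp_continuous_within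
    unfolding A_def B_def by blast+
  then obtain d1 d2 where d: "d1 > 0" "\<And>y. dist y x < d1 \<Longrightarrow> dist (A y) (A x) < e"
    "d2 > 0" "\<And>y. dist y x < d2 \<Longrightarrow> dist (B y) (B x) < e"
    using \<open>e > 0\<close> unfolding continuous_at_eps_delta by (metis dist_norm)
  obtain d3 where d3: "d3 > 0" "ball x d3 \<subseteq> S"
    using assms openE by blast
  define r where "r = min d1 (min d2 d3)"
  \<comment> \<open>Every point of the parallelogram lies within t (|u| + |v|) of \<open>x\<close>;
    the summand 1 keeps the denominator positive and makes this strictly less than
    \<open>r\<close>.\<close>
  define t where "t = r / (norm u + norm v + 1)"
  have "r > 0" using d d3 by (simp add: r_def)
  then have "t > 0" unfolding t_def by (auto intro!: divide_pos_pos add_nonneg_pos)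
  have near: "dist (x + a *\<^sub>R u + b *\<^sub>R v) x < r" if "0 \<le> a" "a \<le> t" "0 \<le> b" "b \<le> t" for a b
  proof -
    have "norm (a *\<^sub>R u + b *\<^sub>R v) \<le> a * norm u + b * norm v"
      using norm_triangle_ineq[of "a *\<^sub>R u" "b *\<^sub>R v"] that by simp
    also have "\<dots> \<le> t * norm u + t * norm v"
      using that by (intro add_mono mult_right_mono) auto
    also have "\<dots> < t * (norm u + norm v + 1)" using \<open>t > 0\<close> by (simp add: algebra_simps)
    also have "\<dots> = r"
    proof -
      have "norm u + norm v + 1 \<noteq> 0"
        by (metis add_nonneg_pos add_nonneg_nonneg norm_ge_zero less_irrefl zero_less_one)
      then show ?thesis by (simp add: t_def)
    qed
    finally show ?thesis by (simp add: dist_norm add.assoc)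
  qed
  have S: "x + a *\<^sub>R u + b *\<^sub>R v \<in> S" if "0 \<le> a" "a \<le> t" "0 \<le> b" "b \<le> t" for a b
    using near[OF that] d3 by (auto simp: r_def dist_commute)
  have dd: "h differentiable (at y)" "(\<lambda>y. dir_deriv h y w) differentiable (at y)" if "y \<in> S" for y w
    using assms that smooth_on_dir_deriv smooth_on_differentiable by blast+
  obtain a b where 1: "0 \<le> a" "a \<le> t" "0 \<le> b" "b \<le> t"
    "h (x + t *\<^sub>R u + t *\<^sub>R v) - h (x + t *\<^sub>R u) - h (x + t *\<^sub>R v) + h x
      = t * t * A (x + a *\<^sub>R u + b *\<^sub>R v)"
    using second_difference_mean_value[OF \<open>t > 0\<close>, of h x u v] dd S unfolding A_def by metis
  have S': "x + a *\<^sub>R v + b *\<^sub>R u \<in> S" if "0 \<le> a" "a \<le> t" "0 \<le> b" "b \<le> t" for a b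
    using S[of b a] that by (simp add: algebra_simps)
  obtain a' b' where 2: "0 \<le> a'" "a' \<le> t" "0 \<le> b'" "b' \<le> t"
    "h (x + t *\<^sub>R v + t *\<^sub>R u) - h (x + t *\<^sub>R v) - h (x + t *\<^sub>R u) + h x
      = t * t * B (x + a' *\<^sub>R v + b' *\<^sub>R u)"
    using second_difference_mean_value[OF \<open>t > 0\<close>, of h x v u] dd S' unfolding B_def by metis
  have "t * t * A (x + a *\<^sub>R u + b *\<^sub>R v) = t * t * B (x + b' *\<^sub>R u + a' *\<^sub>R v)"
    using 1(5) 2(5) by (simp add: algebra_simps)
  then have eq: "A (x + a *\<^sub>R u + b *\<^sub>R v) = B (x + b' *\<^sub>R u + a' *\<^sub>R v)" using \<open>t > 0\<close> by simp
  have "dist (A (x + a *\<^sub>R u + b *\<^sub>R v)) (A x) < e" "dist (B (x + b' *\<^sub>R u + a' *\<^sub>R v)) (B x) < e"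
    using near[OF 1(1-4)] near[OF 2(3,4,1,2)] d by (auto simp: r_def)
  then show False using eq by (simp add: e_def dist_real_def abs_if split: if_splits) 
qed

text \<open>Differentiability is known only for fixed arguments of \<open>a y\<close>. Expanding
  \<open>N y\<close> in \<open>Basis\<close> turns the moving argument into scalar coefficients, to
  which the product rule applies. The first summand of the result is the derivative with the
  argument frozen at \<open>N x\<close>.\<close>

lemma has_derivative_linear_field:
  fixes a :: "'x::real_normed_vector \<Rightarrow> 'a::euclidean_space \<Rightarrow> 'b::real_normed_vector"
  assumes "open S" "x \<in> S" and lin: "\<And>y. y \<in> S \<Longrightarrow> linear (a y)"
    and diff: "\<And>z. (\<lambda>y. a y z) differentiable (at x)"
    and N: "(N has_derivative N') (at x)"
  shows "((\<lambda>y. a y (N y)) has_derivative (\<lambda>h. dir_deriv (\<lambda>y. a y (N x)) x h + a x (N' h))) (at x)"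
proof -
  have ex: "(\<Sum>i\<in>Basis. (n \<bullet> i) *\<^sub>R a y i) = a y n" if "y \<in> S" for y n
    using lin[OF that] by (subst (3) euclidean_representation[symmetric]) (simp add: linear_sum linear_cmul)
  have d: "((\<lambda>y. \<Sum>i\<in>Basis. (N y \<bullet> i) *\<^sub>R a y i) has_derivative
      (\<lambda>h. \<Sum>i\<in>Basis. (N x \<bullet> i) *\<^sub>R dir_deriv (\<lambda>y. a y i) x h + (N' h \<bullet> i) *\<^sub>R a x i)) (at x)"
    by (intro has_derivative_sum has_derivative_scaleR has_derivative_inner_left N has_derivative_dir_deriv diff)
  have c: "((\<lambda>y. \<Sum>i\<in>Basis. (n \<bullet> i) *\<^sub>R a y i) has_derivative
      (\<lambda>h. \<Sum>i\<in>Basis. (n \<bullet> i) *\<^sub>R dir_deriv (\<lambda>y. a y i) x h)) (at x)" for n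
    by (intro has_derivative_sum has_derivative_scaleR_right has_derivative_dir_deriv diff)
  have dd: "dir_deriv (\<lambda>y. a y n) x h = (\<Sum>i\<in>Basis. (n \<bullet> i) *\<^sub>R dir_deriv (\<lambda>y. a y i) x h)" for n h
    by (rule dir_deriv_eqI, rule has_derivative_transform_within_open[OF c assms(1,2)]) (rule ex)
  then have "(\<lambda>h. \<Sum>i\<in>Basis. (N x \<bullet> i) *\<^sub>R dir_deriv (\<lambda>y. a y i) x h + (N' h \<bullet> i) *\<^sub>R a x i)
      = (\<lambda>h. dir_deriv (\<lambda>y. a y (N x)) x h + a x (N' h))"
    by (simp only: sum.distrib ex[OF assms(2)] dd[symmetric])
  then show ?thesis
    using has_derivative_transform_within_open[OF d assms(1,2), of "\<lambda>y. a y (N y)"] ex by simp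
qed

lemma Ck_on_linear_field:
  fixes a :: "'x::real_normed_vector \<Rightarrow> 'a::euclidean_space \<Rightarrow> 'b::real_normed_vector"
  assumes "open S" and lin: "\<And>y. y \<in> S \<Longrightarrow> linear (a y)"
    and a: "\<And>z. Ck_on k S (\<lambda>y. a y z)" and N: "Ck_on k S N"
  shows "Ck_on k S (\<lambda>y. a y (N y))"
proof -
  have ex: "(\<Sum>i\<in>Basis. (n \<bullet> i) *\<^sub>R a y i) = a y n" if "y \<in> S" for y n
    using lin[OF that] by (subst (3) euclidean_representation[symmetric]) (simp add: linear_sum linear_cmul)
  have "Ck_on k S (\<lambda>y. \<Sum>i\<in>Basis. (N y \<bullet> i) *\<^sub>R a y i)"
    by (intro Ck_on_sum[OF assms(1)] Ck_on_bounded_bilinear[OF assms(1) bounded_bilinear_scaleR] a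
        Ck_on_bounded_linear[OF assms(1) bounded_linear_inner_left] N)
  then show ?thesis by (rule Ck_on_cong[OF assms(1), rotated]) (rule ex)
qed

lemma linear_dir_deriv_field:
  assumes "open S" "x \<in> S" and lin: "\<And>y. y \<in> S \<Longrightarrow> linear (a y)"
    and diff: "\<And>z. (\<lambda>y. a y z) differentiable (at x)"
  shows "linear (\<lambda>z. dir_deriv (\<lambda>y. a y z) x u)"
proof (rule linearI)
  fix z z' c
  have "((\<lambda>y. a y z + a y z') has_derivative (\<lambda>u. dir_deriv (\<lambda>y. a y z) x u + dir_deriv (\<lambda>y. a y z') x u)) (at x)"
    by (intro has_derivative_add has_derivative_dir_deriv diff)
  from dir_deriv_eqI[OF has_derivative_transform_within_open[OF this assms(1,2)], of "\<lambda>y. a y (z + z')"]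
  show "dir_deriv (\<lambda>y. a y (z + z')) x u = dir_deriv (\<lambda>y. a y z) x u + dir_deriv (\<lambda>y. a y z') x u"
    using lin linear_add by metis
  have "((\<lambda>y. c *\<^sub>R a y z) has_derivative (\<lambda>u. c *\<^sub>R dir_deriv (\<lambda>y. a y z) x u)) (at x)"
    by (intro has_derivative_scaleR_right has_derivative_dir_deriv diff)
  from dir_deriv_eqI[OF has_derivative_transform_within_open[OF this assms(1,2)], of "\<lambda>y. a y (c *\<^sub>R z)"]
  show "dir_deriv (\<lambda>y. a y (c *\<^sub>R z)) x u = c *\<^sub>R dir_deriv (\<lambda>y. a y z) x u"
    using lin linear_cmul by metis
qed

text \<open>The linear case used twice: first with the second argument frozen, then for the linear
  field obtained by inserting \<open>N y\<close>.\<close>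

lemma has_derivative_bilinear_field:
  fixes G :: "'x::real_normed_vector \<Rightarrow> 'a::euclidean_space \<Rightarrow> 'b::euclidean_space \<Rightarrow> 'c::real_normed_vector"
  assumes "open S" "x \<in> S" and bil: "\<And>y. y \<in> S \<Longrightarrow> bilinear (G y)"
    and diff: "\<And>u v. (\<lambda>y. G y u v) differentiable (at x)"
    and N: "(N has_derivative N') (at x)" and M: "(M has_derivative M') (at x)"
  shows "((\<lambda>y. G y (N y) (M y)) has_derivative
    (\<lambda>h. dir_deriv (\<lambda>y. G y (N x) (M x)) x h + G x (N' h) (M x) + G x (N x) (M' h))) (at x)"
proof -
  have 1: "((\<lambda>y. G y (N y) m) has_derivative
      (\<lambda>h. dir_deriv (\<lambda>y. G y (N x) m) x h + G x (N' h) m)) (at x)" for m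
    using bil by (intro has_derivative_linear_field[where a = "\<lambda>y n. G y n m", OF assms(1,2) _ diff N])
      (auto simp: bilinear_def)
  have "((\<lambda>y. G y (N y) (M y)) has_derivative
      (\<lambda>h. dir_deriv (\<lambda>y. G y (N y) (M x)) x h + G x (N x) (M' h))) (at x)"
    using bil differentiableI[OF 1]
    by (intro has_derivative_linear_field[where a = "\<lambda>y m. G y (N y) m", OF assms(1,2) _ _ M])
      (auto simp: bilinear_def)
  then show ?thesis by (simp add: dir_deriv_eqI[OF 1])
qed

section \<open>Scalar products and local Levi-Civita calculus\<close>

lemma scalar_productD:
  assumes "scalar_product b"
  shows "bilinear b" "b u v = b v u" "linear (b u)" "linear (\<lambda>u. b u v)"
  using assms unfolding scalar_product_def bilinear_def by auto

lemma scalar_product_eqI: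
  assumes "scalar_product b" "\<And>z. b u z = b w z"
  shows "u = w"
proof -
  have "b (u - w) z = 0" for z
    using assms scalar_productD(1)[OF assms(1)] by (simp add: bilinear_lsub)
  then show ?thesis using assms(1) unfolding scalar_product_def by fastforce
qed

lemma sharp_eqI:
  assumes "scalar_product b" "\<And>z. b w z = \<alpha> z"
  shows "sharp b \<alpha> = w"
  unfolding sharp_def using assms by (intro the_equality) (auto intro: scalar_product_eqI)

text \<open>Existence behind the definite description: encoding the covector \<open>b u\<close> by
  its values on \<open>Basis\<close> gives an endomorphism \<open>T\<close>, which is injective by
  nondegeneracy and hence surjective in finite dimension.\<close>

lemma sharp_works:
  assumes b: "scalar_product b" and "linear \<alpha>"
  shows "b (sharp b \<alpha>) z = \<alpha> z"
proof -
  define T where "T u = (\<Sum>e\<in>Basis. b u e *\<^sub>R e)" for u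
  have eq: "\<alpha>' = \<beta>'" if "linear \<alpha>'" "linear \<beta>'" "(\<Sum>e\<in>Basis. \<alpha>' e *\<^sub>R e) = (\<Sum>e\<in>Basis. \<beta>' e *\<^sub>R e)"
    for \<alpha>' \<beta>' :: "'a \<Rightarrow> real"
  proof (rule linear_eq_stdbasis[OF that(1,2)])
    fix e :: 'a assume "e \<in> Basis"
    then show "\<alpha>' e = \<beta>' e" using arg_cong[OF that(3), of "\<lambda>w. w \<bullet> e"] by simp
  qed
  have "linear T"
    unfolding T_def
    by (intro linear_compose_sum ballI linear_compose[OF scalar_productD(4)[OF b], unfolded o_def])
      (simp add: linear_iff scaleR_add_left)
  moreover have "inj T"
    using eq scalar_productD[OF b] scalar_product_eqI[OF b] unfolding inj_def T_def by metis
  ultimately have "surj T" using linear_injective_imp_surjective by blast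
  then obtain w where "T w = (\<Sum>e\<in>Basis. \<alpha> e *\<^sub>R e)" by (metis surjD)
  then have "b w = \<alpha>" using eq scalar_productD(3)[OF b] assms(2) unfolding T_def by blast
  then show ?thesis using sharp_eqI[OF b, of w \<alpha>] by simp
qed

lemma linear_eq_sum_Basis:
  fixes \<alpha> :: "'a::euclidean_space \<Rightarrow> 'b::real_vector"
  assumes "linear \<alpha>"
  shows "\<alpha> z = (\<Sum>e\<in>Basis. (z \<bullet> e) *\<^sub>R \<alpha> e)"
  by (subst euclidean_representation[of z, symmetric]) (simp only: linear_sum[OF assms] linear_cmul[OF assms])

text \<open>Isolates the dependence on the metric in finitely many vectors, the duals of the
  coordinate functionals; smoothness of every raised covector field reduces to theirs.\<close>

lemma sharp_eq_sum_Basis: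
  assumes b: "scalar_product b" and "linear \<alpha>"
  shows "sharp b \<alpha> = (\<Sum>e\<in>Basis. \<alpha> e *\<^sub>R sharp b (\<lambda>z. z \<bullet> e))"
proof (rule sharp_eqI[OF b])
  fix z
  have l: "linear (\<lambda>z::'a. z \<bullet> e)" for e by (simp add: linear_iff inner_add_left)
  have "b (\<Sum>e\<in>Basis. \<alpha> e *\<^sub>R sharp b (\<lambda>z. z \<bullet> e)) z = (\<Sum>e\<in>Basis. \<alpha> e * b (sharp b (\<lambda>z. z \<bullet> e)) z)"
    by (simp only: linear_sum[OF scalar_productD(4)[OF b]] linear_cmul[OF scalar_productD(4)[OF b]] real_scaleR_def)
  also have "\<dots> = \<alpha> z" 
    unfolding sharp_works[OF b l] linear_eq_sum_Basis[OF assms(2), of z] by (simp add: mult.commute)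
  finally show "b (\<Sum>e\<in>Basis. \<alpha> e *\<^sub>R sharp b (\<lambda>z. z \<bullet> e)) z = \<alpha> z" .
qed

text \<open>\<open>H y\<close> is O(y - x) and \<open>g\<close> tends to 0, so the product is o(y -
  x). Mere convergence of \<open>g\<close> is what is available when \<open>g\<close> comes from a
  solution whose differentiability is still to be shown.\<close>

lemma has_derivative_scaleR_null:
  fixes H :: "'a::real_normed_vector \<Rightarrow> 'b::real_normed_vector"
  assumes g: "(g \<longlongrightarrow> 0) (at x)" and H: "(H has_derivative D) (at x)" and 0: "H x = 0"
  shows "((\<lambda>y. g y *\<^sub>R H y) has_derivative (\<lambda>h. 0)) (at x)"
proof -
  have D: "bounded_linear D" using H has_derivative_bounded_linear by blast
  then obtain K where K: "\<And>h. norm (D h) \<le> norm h * K" using bounded_linear.bounded by metis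
  have r: "((\<lambda>y. norm (H y - D (y - x)) / norm (y - x)) \<longlongrightarrow> 0) (at x)"
    using H 0 by (simp add: has_derivative_iff_norm)
  have "((\<lambda>y. \<bar>g y\<bar> * (K + norm (H y - D (y - x)) / norm (y - x))) \<longlongrightarrow> 0 * (K + 0)) (at x)"
    using g r tendsto_rabs_zero by (intro tendsto_intros) blast+
  then have lim: "((\<lambda>y. \<bar>g y\<bar> * (K + norm (H y - D (y - x)) / norm (y - x))) \<longlongrightarrow> 0) (at x)" by simp
  have "norm (g y *\<^sub>R H y) / norm (y - x) \<le> \<bar>g y\<bar> * (K + norm (H y - D (y - x)) / norm (y - x))"
    if "y \<noteq> x" for y
  proof -
    have "norm (H y) \<le> norm (D (y - x)) + norm (H y - D (y - x))"
      using norm_triangle_ineq[of "D (y - x)" "H y - D (y - x)"] by simp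
    also have "\<dots> \<le> norm (y - x) * K + norm (H y - D (y - x))" using K by simp
    finally have "norm (H y) / norm (y - x) \<le> K + norm (H y - D (y - x)) / norm (y - x)"
      using that by (simp add: divide_simps mult.commute)
    then have "\<bar>g y\<bar> * (norm (H y) / norm (y - x)) \<le> \<bar>g y\<bar> * (K + norm (H y - D (y - x)) / norm (y - x))"
      by (rule mult_left_mono) simp
    then show ?thesis by simp
  qed
  then have "((\<lambda>y. norm (g y *\<^sub>R H y) / norm (y - x)) \<longlongrightarrow> 0) (at x)"
    by (intro Lim_null_comparison[OF _ lim]) (auto simp: eventually_at_filter)
  then show ?thesis using 0 by (simp add: has_derivative_iff_norm)
qed

text \<open>A solution of a linear system that is a differentiable perturbation of the identity:
  the estimate \<open>norm (w y) \<le> 2 * norm (P y)\<close> makes the perturbation term \<open>o(y - x)\<close>.\<close>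

lemma differentiable_perturbed_identity:
  fixes w :: "'x::real_normed_vector \<Rightarrow> 'a::euclidean_space"
  assumes "open S" "x \<in> S"
    and w: "\<And>y. y \<in> S \<Longrightarrow> w y = P y - (\<Sum>i\<in>Basis. (w y \<bullet> i) *\<^sub>R H i y)"
    and P: "P differentiable (at x)" "P x = 0"
    and H: "\<And>i. i \<in> Basis \<Longrightarrow> H i differentiable (at x)" "\<And>i. i \<in> Basis \<Longrightarrow> H i x = 0"
  shows "w differentiable (at x)"
proof -
  have "(P \<longlongrightarrow> 0) (at x)" and H0: "(H i \<longlongrightarrow> 0) (at x)" if "i \<in> Basis" for i
    using that P H differentiable_imp_continuous_within by (metis continuous_within)+
  then have P0: "(P \<longlongrightarrow> 0) (at x)" using nonempty_Basis by blast
  have "((\<lambda>y. \<Sum>i\<in>Basis. norm (H i y)) \<longlongrightarrow> (\<Sum>i\<in>(Basis::'a set). 0)) (at x)"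
    using H0 by (intro tendsto_sum tendsto_norm_zero)
  then have "eventually (\<lambda>y. (\<Sum>i\<in>Basis. norm (H i y)) < 1/2) (at x)"
    by (intro order_tendstoD(2)[of _ 0]) auto
  moreover have "eventually (\<lambda>y. y \<in> S) (at x)"
    using assms(1,2) by (rule eventually_at_in_open')
  ultimately have "eventually (\<lambda>y. norm (w y) \<le> 2 * norm (P y)) (at x)"
  proof eventually_elim
    case (elim y)
    have "norm (\<Sum>i\<in>Basis. (w y \<bullet> i) *\<^sub>R H i y) \<le> (\<Sum>i\<in>Basis. norm (w y) * norm (H i y))"
      by (intro sum_norm_le) (auto intro!: mult_right_mono Basis_le_norm)
    also have "\<dots> = norm (w y) * (\<Sum>i\<in>Basis. norm (H i y))" by (simp add: sum_distrib_left)
    also have "\<dots> \<le> norm (w y) * (1/2)" using elim by (intro mult_left_mono) auto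
    finally have "norm (w y) \<le> norm (P y) + norm (w y) * (1/2)"
      using arg_cong[OF w[OF elim(2)], of norm] norm_triangle_ineq4[of "P y" "\<Sum>i\<in>Basis. (w y \<bullet> i) *\<^sub>R H i y"]
      by linarith
    then show ?case by simp
  qed
  moreover have "((\<lambda>y. 2 * norm (P y)) \<longlongrightarrow> 0) (at x)"
    using P0 by (intro tendsto_mult_right_zero tendsto_norm_zero)
  ultimately have w0: "(w \<longlongrightarrow> 0) (at x)" by (rule Lim_null_comparison)
  have "((\<lambda>y. (w y \<bullet> i) *\<^sub>R H i y) has_derivative (\<lambda>h. 0)) (at x)" if i: "i \<in> Basis" for i
  proof -
    have "((\<lambda>y. w y \<bullet> i) \<longlongrightarrow> 0 \<bullet> i) (at x)" using w0 by (intro tendsto_inner tendsto_const)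
    then show ?thesis
      using has_derivative_scaleR_null[OF _ has_derivative_dir_deriv[OF H(1)[OF i]] H(2)[OF i]] by simp
  qed
  then have "((\<lambda>y. P y - (\<Sum>i\<in>Basis. (w y \<bullet> i) *\<^sub>R H i y)) has_derivative
      (\<lambda>h. dir_deriv P x h - (\<Sum>i\<in>(Basis::'a set). 0))) (at x)"
    by (intro has_derivative_diff[OF has_derivative_dir_deriv[OF P(1)]] has_derivative_sum)
  from differentiableI[OF this] show ?thesis
    by (intro differentiable_cong_open[OF assms(1) _ assms(2), where h' = w]) (rule w[symmetric])
qed

lemma linear_inner_right_fixed: "linear (\<lambda>z::'a::euclidean_space. z \<bullet> e)"
  by (simp add: linear_iff inner_add_left)

section \<open>Levi-Civita calculus in a single chart\<close>

locale local_semi_riemannian =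
  fixes S :: "'a::euclidean_space set" and G :: "'a \<Rightarrow> 'a \<Rightarrow> 'a \<Rightarrow> real"
  assumes open_S: "open S"
    and smooth_G: "smooth_on S (\<lambda>x. G x u v)"
    and scalar_product_G: "x \<in> S \<Longrightarrow> scalar_product (G x)"
begin

lemma bilinear_G: "x \<in> S \<Longrightarrow> bilinear (G x)"
  by (simp add: scalar_product_G scalar_productD)

lemma G_commute: "x \<in> S \<Longrightarrow> G x u v = G x v u"
  by (simp add: scalar_product_G scalar_productD(2))

lemma differentiable_G: "x \<in> S \<Longrightarrow> (\<lambda>x. G x u v) differentiable (at x)"
  by (rule smooth_on_differentiable[OF smooth_G])

lemma G_eqI: "x \<in> S \<Longrightarrow> (\<And>z. G x u z = G x w z) \<Longrightarrow> u = w"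
  using scalar_product_eqI[OF scalar_product_G] .

lemma linear_dir_deriv_G:
  assumes "x \<in> S"
  shows "linear (\<lambda>v. dir_deriv (\<lambda>y. G y u v) x w)" "linear (\<lambda>u. dir_deriv (\<lambda>y. G y u v) x w)"
  using linear_dir_deriv_field[OF open_S assms, of "\<lambda>y. G y u"]
    linear_dir_deriv_field[OF open_S assms, of "\<lambda>y u. G y u v"] 
    scalar_productD(3,4)[OF scalar_product_G] differentiable_G[OF assms] by blast+

abbreviation dual_Basis where "dual_Basis e y \<equiv> sharp (G y) (\<lambda>z. z \<bullet> e)"

lemma G_dual_Basis: "y \<in> S \<Longrightarrow> G y (dual_Basis e y) z = z \<bullet> e"
  by (simp add: sharp_works[OF scalar_product_G linear_inner_right_fixed])

text \<open>Write N for the dual vector and w(y) = N(y) - N(x). Since G_y N(y) and G_x N(x) are the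
  same functional, G_x w = (G_x - G_y) N(x) - (G_y - G_x) w. Raising indices with the fixed metric
  at \<open>x\<close> brings this into the form of
  \<open>differentiable_perturbed_identity\<close>.\<close>

lemma differentiable_dual_Basis:
  assumes x: "x \<in> S"
  shows "dual_Basis e differentiable (at x)"
proof -
  define N where "N y = dual_Basis e y" for y
  define w where "w y = N y - N x" for y
  \<comment> \<open>\<open>P y\<close> and \<open>H i y\<close> are the covectors (G_x - G_y)(N(x),
    .) and (G_y - G_x)(i, .) raised with \<open>G x\<close>; both vanish at
    \<open>y = x\<close>.\<close>
  define P where "P y = (\<Sum>e\<in>Basis. (G x (N x) e - G y (N x) e) *\<^sub>R dual_Basis e x)" for y
  define H where "H i y = (\<Sum>e\<in>Basis. (G y i e - G x i e) *\<^sub>R dual_Basis e x)" for i y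
  have "w y = P y - (\<Sum>i\<in>Basis. (w y \<bullet> i) *\<^sub>R H i y)" if y: "y \<in> S" for y
  proof (rule G_eqI[OF x])
    fix z
    note lin = scalar_productD(3,4)[OF scalar_product_G]
    have P: "G x (P y) z = G x (N x) z - G y (N x) z"
    proof -
      have "G x (P y) z = (\<Sum>e\<in>Basis. (G x (N x) e - G y (N x) e) * (z \<bullet> e))"
        unfolding P_def by (simp add: linear_sum[OF lin(2)[OF x]] linear_cmul[OF lin(2)[OF x]] G_dual_Basis[OF x])
      also have "\<dots> = (\<Sum>e\<in>Basis. (z \<bullet> e) *\<^sub>R G x (N x) e) - (\<Sum>e\<in>Basis. (z \<bullet> e) *\<^sub>R G y (N x) e)"
        by (simp add: sum_subtractf algebra_simps)
      finally show ?thesis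
        using linear_eq_sum_Basis[OF lin(1)[OF x]] linear_eq_sum_Basis[OF lin(1)[OF y]] by metis
    qed
    have H: "G x (H i y) z = G y i z - G x i z" for i
    proof -
      have "G x (H i y) z = (\<Sum>e\<in>Basis. (G y i e - G x i e) * (z \<bullet> e))"
        unfolding H_def by (simp add: linear_sum[OF lin(2)[OF x]] linear_cmul[OF lin(2)[OF x]] G_dual_Basis[OF x])
      also have "\<dots> = (\<Sum>e\<in>Basis. (z \<bullet> e) *\<^sub>R G y i e) - (\<Sum>e\<in>Basis. (z \<bullet> e) *\<^sub>R G x i e)"
        by (simp add: sum_subtractf algebra_simps)
      finally show ?thesis
        using linear_eq_sum_Basis[OF lin(1)[OF x]] linear_eq_sum_Basis[OF lin(1)[OF y]] by metis
    qed
    have "G x (\<Sum>i\<in>Basis. (w y \<bullet> i) *\<^sub>R H i y) z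
        = (\<Sum>i\<in>Basis. (w y \<bullet> i) *\<^sub>R G y i z) - (\<Sum>i\<in>Basis. (w y \<bullet> i) *\<^sub>R G x i z)"
      by (simp add: linear_sum[OF lin(2)[OF x]] linear_cmul[OF lin(2)[OF x]] H sum_subtractf algebra_simps)
    also have "\<dots> = G y (w y) z - G x (w y) z"
      using linear_eq_sum_Basis[OF lin(2)[OF x]] linear_eq_sum_Basis[OF lin(2)[OF y]] by metis
    finally have "G x (P y - (\<Sum>i\<in>Basis. (w y \<bullet> i) *\<^sub>R H i y)) z
        = G x (N x) z - G y (N x) z - (G y (w y) z - G x (w y) z)"
      by (simp add: linear_diff[OF lin(2)[OF x]] P)
    also have "\<dots> = G x (w y) z"
      using G_dual_Basis[OF x, of e z] G_dual_Basis[OF y, of e z]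
      by (simp add: w_def N_def linear_diff[OF lin(2)[OF y]])
    finally show "G x (w y) z = G x (P y - (\<Sum>i\<in>Basis. (w y \<bullet> i) *\<^sub>R H i y)) z" by simp
  qed
  moreover have "(\<lambda>y. (G x i j - G y i j) *\<^sub>R v) differentiable (at x)"
    "(\<lambda>y. (G y i j - G x i j) *\<^sub>R v) differentiable (at x)" for i j and v :: 'a
    using differentiable_G[OF x] 
    by (auto intro!: derivative_intros)
  then have "P differentiable (at x)" "\<And>i. H i differentiable (at x)"
    unfolding P_def H_def by (auto intro!: differentiable_sum)
  ultimately have "w differentiable (at x)"
    by (intro differentiable_perturbed_identity[OF open_S x, of w P H]) (auto simp: P_def H_def)
  then have "(\<lambda>y. w y + N x) differentiable (at x)" by (intro derivative_intros)
  then show ?thesis by (simp add: w_def N_def)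
qed

text \<open>The pairing \<open>G y (dual_Basis e y) z\<close> does not depend on \<open>y\<close>.
  Setting its derivative to zero determines the derivative of the dual vector by its pairings with
  all \<open>z\<close>.\<close>

lemma dir_deriv_dual_Basis:
  assumes x: "x \<in> S"
  shows "dir_deriv (dual_Basis e) x u
    = (\<Sum>e'\<in>Basis. (- dir_deriv (\<lambda>y. G y (dual_Basis e x) e') x u) *\<^sub>R dual_Basis e' x)"
proof -
  let ?\<beta> = "\<lambda>z. - dir_deriv (\<lambda>y. G y (dual_Basis e x) z) x u"
  have "sharp (G x) ?\<beta> = dir_deriv (dual_Basis e) x u"
  proof (rule sharp_eqI[OF scalar_product_G[OF x]])
    fix z
    have "((\<lambda>y. G y (dual_Basis e y) z) has_derivative
       (\<lambda>h. dir_deriv (\<lambda>y. G y (dual_Basis e x) z) x h + G x (dir_deriv (dual_Basis e) x h) z + G x (dual_Basis e x) 0)) (at x)"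
      using has_derivative_bilinear_field[OF open_S x bilinear_G differentiable_G[OF x]
          has_derivative_dir_deriv[OF differentiable_dual_Basis[OF x]] has_derivative_const] .
    from has_derivative_transform_within_open[OF this open_S x, of "\<lambda>y. z \<bullet> e"]
    have "dir_deriv (\<lambda>y. z \<bullet> e) x u
       = dir_deriv (\<lambda>y. G y (dual_Basis e x) z) x u + G x (dir_deriv (dual_Basis e) x u) z + G x (dual_Basis e x) 0"
      by (intro dir_deriv_eqI) (simp add: G_dual_Basis)
    then show "G x (dir_deriv (dual_Basis e) x u) z = ?\<beta> z"
      by (simp add: bilinear_rzero[OF bilinear_G[OF x]])
  qed
  moreover have "linear ?\<beta>" using linear_dir_deriv_G[OF x] by (simp add: linear_compose_neg)
  ultimately show ?thesis using sharp_eq_sum_Basis[OF scalar_product_G[OF x]] by simp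
qed

text \<open>By the derivative formula above, each derivative of the dual basis is polynomial in the dual basis
  and the derivatives of \<open>G\<close>, so regularity can be bootstrapped.\<close>

lemma smooth_dual_Basis: "smooth_on S (dual_Basis e)"
proof -
  have "Ck_on k S (dual_Basis e)" for k e
  proof (induction k arbitrary: e)
    case 0
    then show ?case
      by (auto intro!: continuous_at_imp_continuous_on differentiable_imp_continuous_within differentiable_dual_Basis)
  next
    case (Suc k)
    have G: "Ck_on k S (\<lambda>x. dir_deriv (\<lambda>y. G y v e') x u)" for v e' u
      using smooth_on_dir_deriv[OF smooth_G] by (simp add: smooth_on_def)
    have "Ck_on k S (\<lambda>x. dir_deriv (\<lambda>y. G y (dual_Basis e x) e') x u)" for e' u
      using Ck_on_linear_field[OF open_S, where a = "\<lambda>x v. dir_deriv (\<lambda>y. G y v e') x u", OF _ G Suc.IH]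
        linear_dir_deriv_G(2) by blast
    then have "Ck_on k S (\<lambda>x. - dir_deriv (\<lambda>y. G y (dual_Basis e x) e') x u)" for e' u
      using Ck_on_bounded_linear[OF open_S bounded_linear_minus[OF bounded_linear_ident]] by blast
    then have "Ck_on k S (\<lambda>x. \<Sum>e'\<in>Basis. (- dir_deriv (\<lambda>y. G y (dual_Basis e x) e') x u) *\<^sub>R dual_Basis e' x)" for u
      by (intro Ck_on_sum[OF open_S] Ck_on_bounded_bilinear[OF open_S bounded_bilinear_scaleR] Suc.IH)
    then have "Ck_on k S (\<lambda>x. dir_deriv (dual_Basis e) x u)" for u
      using Ck_on_cong[OF open_S, rotated] dir_deriv_dual_Basis by (metis (mono_tags, lifting))
    then show ?case using differentiable_dual_Basis by simp
  qed
  then show ?thesis by (simp add: smooth_on_def)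
qed

lemma smooth_sharp:
  assumes "\<And>x. x \<in> S \<Longrightarrow> linear (a x)" "\<And>z. smooth_on S (\<lambda>x. a x z)"
  shows "smooth_on S (\<lambda>x. sharp (G x) (a x))"
proof (rule smooth_on_cong[OF open_S])
  show "(\<Sum>e\<in>Basis. a x e *\<^sub>R dual_Basis e x) = sharp (G x) (a x)" if "x \<in> S" for x
    using sharp_eq_sum_Basis[OF scalar_product_G[OF that] assms(1)[OF that]] by simp
  show "smooth_on S (\<lambda>x. \<Sum>e\<in>Basis. a x e *\<^sub>R dual_Basis e x)"
    by (intro smooth_on_sum[OF open_S] smooth_on_bounded_bilinear[OF open_S bounded_bilinear_scaleR]
        assms(2) smooth_dual_Basis)
qed

abbreviation koszul where
  "koszul x u v z \<equiv> (dir_deriv (\<lambda>y. G y v z) x u + dir_deriv (\<lambda>y. G y u z) x v - dir_deriv (\<lambda>y. G y u v) x z) / 2"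

lemma linear_koszul:
  assumes "x \<in> S"
  shows "linear (koszul x u v)"
proof -
  have "linear (\<lambda>z. dir_deriv (\<lambda>y. G y u v) x z)"
    using differentiable_G[OF assms] by (simp add: linear_frechet_derivative)
  then have "linear (\<lambda>z. (1/2) *\<^sub>R (dir_deriv (\<lambda>y. G y v z) x u + dir_deriv (\<lambda>y. G y u z) x v - dir_deriv (\<lambda>y. G y u v) x z))"
    using linear_dir_deriv_G[OF assms] by (intro linear_compose_scale_right linear_compose_sub linear_compose_add)
  then show ?thesis by simp
qed

lemma G_christoffel: "x \<in> S \<Longrightarrow> G x (christoffel G x u v) z = koszul x u v z"
  unfolding christoffel_def by (rule sharp_works[OF scalar_product_G linear_koszul])

lemma christoffel_eqI: "x \<in> S \<Longrightarrow> (\<And>z. G x w z = koszul x u v z) \<Longrightarrow> christoffel G x u v = w"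
  unfolding christoffel_def by (rule sharp_eqI[OF scalar_product_G])

lemma dir_deriv_G_commute: "x \<in> S \<Longrightarrow> dir_deriv (\<lambda>y. G y u v) x = dir_deriv (\<lambda>y. G y v u) x"
  by (intro dir_deriv_cong_open[OF open_S] G_commute)

text \<open>Torsion-freeness, since constant fields have vanishing Lie bracket.\<close>

lemma christoffel_commute: "x \<in> S \<Longrightarrow> christoffel G x u v = christoffel G x v u"
  using dir_deriv_G_commute by (intro christoffel_eqI) (simp_all add: G_christoffel)

text \<open>Metric compatibility: in the sum of the Koszul expressions for (u, v, z) and (u, z, v)
  everything cancels except the derivative along \<open>u\<close>.\<close>

lemma dir_deriv_G:
  assumes "x \<in> S"
  shows "dir_deriv (\<lambda>y. G y v z) x u = G x (christoffel G x u v) z + G x v (christoffel G x u z)"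
  using G_commute[OF assms, of v "christoffel G x u z"] dir_deriv_G_commute[OF assms, of v z]
    dir_deriv_G_commute[OF assms, of v u]
  by (simp add: G_christoffel[OF assms] field_simps)

lemma bilinear_christoffel:
  assumes x: "x \<in> S"
  shows "bilinear (christoffel G x)"
proof -
  have "linear (christoffel G x u)" for u
  proof (rule linearI)
    note l = linear_dir_deriv_G[OF x] 
    have l2: "linear (dir_deriv (\<lambda>y. G y u z) x)" for u z
      using differentiable_G[OF x] by (simp add: linear_frechet_derivative)
    note s = linear_add[OF l(1)] linear_add[OF l(2)] linear_add[OF l2] 
      linear_cmul[OF l(1)] linear_cmul[OF l(2)] linear_cmul[OF l2] 
    fix v w c
    show "christoffel G x u (v + w) = christoffel G x u v + christoffel G x u w"
      using x by (intro christoffel_eqI)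
        (simp_all add: bilinear_ladd[OF bilinear_G] G_christoffel s field_simps)
    show "christoffel G x u (c *\<^sub>R v) = c *\<^sub>R christoffel G x u v"
      using x by (intro christoffel_eqI)
        (simp_all add: bilinear_lmul[OF bilinear_G] G_christoffel s field_simps)
  qed
  moreover have "christoffel G x u v = christoffel G x v u" for u v
    by (rule christoffel_commute[OF x])
  ultimately show ?thesis unfolding bilinear_def linear_iff by metis
qed

lemma smooth_christoffel: "smooth_on S (\<lambda>x. christoffel G x u v)"
  unfolding christoffel_def
proof (rule smooth_sharp)
  fix z
  note d = smooth_on_dir_deriv[OF smooth_G]
  have "smooth_on S (\<lambda>x. (1/2) *\<^sub>R (dir_deriv (\<lambda>y. G y v z) x u + dir_deriv (\<lambda>y. G y u z) x v + (-1) *\<^sub>R dir_deriv (\<lambda>y. G y u v) x z))"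
    by (intro smooth_on_bounded_linear[OF open_S bounded_linear_scaleR_right] smooth_on_add[OF open_S] d)
  then show "smooth_on S (\<lambda>x. koszul x u v z)" by simp
qed (rule linear_koszul)

lemma has_derivative_christoffel:
  assumes "x \<in> S" "(N has_derivative N') (at x)" "(M has_derivative M') (at x)"
  shows "((\<lambda>y. christoffel G y (N y) (M y)) has_derivative
    (\<lambda>h. dir_deriv (\<lambda>y. christoffel G y (N x) (M x)) x h + christoffel G x (N' h) (M x)
       + christoffel G x (N x) (M' h))) (at x)"
  by (rule has_derivative_bilinear_field[OF open_S assms(1) bilinear_christoffel
        smooth_on_differentiable[OF smooth_christoffel assms(1)] assms(2,3)])

lemma has_derivative_G:
  assumes "x \<in> S" "(N has_derivative N') (at x)" "(M has_derivative M') (at x)"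
  shows "((\<lambda>y. G y (N y) (M y)) has_derivative
    (\<lambda>h. dir_deriv (\<lambda>y. G y (N x) (M x)) x h + G x (N' h) (M x) + G x (N x) (M' h))) (at x)"
  using has_derivative_bilinear_field[OF open_S assms(1) bilinear_G differentiable_G[OF assms(1)] assms(2,3)] .

end

section \<open>Gradient and Hessian\<close>

locale local_scalar_field = local_semi_riemannian S G
  for S :: "'a::euclidean_space set" and G +
  fixes \<phi> :: "'a \<Rightarrow> real"
  assumes smooth_\<phi>: "smooth_on S \<phi>"
begin

abbreviation grad where "grad x \<equiv> sharp (G x) (dir_deriv \<phi> x)"

lemma linear_dir_deriv_\<phi>: "x \<in> S \<Longrightarrow> linear (dir_deriv \<phi> x)"
  using smooth_on_differentiable[OF smooth_\<phi>] by (simp add: linear_frechet_derivative)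

lemma G_grad: "x \<in> S \<Longrightarrow> G x (grad x) z = dir_deriv \<phi> x z"
  by (rule sharp_works[OF scalar_product_G linear_dir_deriv_\<phi>])

lemma smooth_grad: "smooth_on S grad"
  by (intro smooth_sharp linear_dir_deriv_\<phi> smooth_on_dir_deriv smooth_\<phi>)

lemma has_derivative_grad: "x \<in> S \<Longrightarrow> (grad has_derivative dir_deriv grad x) (at x)"
  by (rule smooth_on_has_derivative[OF smooth_grad])

abbreviation nabla_grad where "nabla_grad x u \<equiv> dir_deriv grad x u + christoffel G x u (grad x)"

text \<open>Differentiating \<open>G y (grad y) z = dir_deriv \<phi> y z\<close> for constant
  \<open>z\<close> and removing the derivative of \<open>G\<close> by metric compatibility leaves
  the Hessian, which is thus the lowered covariant derivative of the gradient.\<close>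

lemma G_nabla_grad:
  assumes x: "x \<in> S"
  shows "G x (nabla_grad x u) z = local_hessian G \<phi> x u z"
proof -
  have "((\<lambda>y. G y (grad y) z) has_derivative
      (\<lambda>h. dir_deriv (\<lambda>y. G y (grad x) z) x h + G x (dir_deriv grad x h) z + G x (grad x) 0)) (at x)"
    by (rule has_derivative_G[OF x has_derivative_grad[OF x] has_derivative_const])
  from has_derivative_transform_within_open[OF this open_S x, of "\<lambda>y. dir_deriv \<phi> y z"]
  have "dir_deriv (\<lambda>y. dir_deriv \<phi> y z) x u
      = dir_deriv (\<lambda>y. G y (grad x) z) x u + G x (dir_deriv grad x u) z + G x (grad x) 0"
    by (intro dir_deriv_eqI) (simp add: G_grad)
  then show ?thesis
    by (simp add: local_hessian_def bilinear_ladd[OF bilinear_G[OF x]] dir_deriv_G[OF x]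
        G_grad[OF x] bilinear_rzero[OF bilinear_G[OF x]])
qed

lemma nabla_grad_eq:
  assumes x: "x \<in> S" and hess: "\<And>z. local_hessian G \<phi> x u z = k * \<phi> x * G x u z"
  shows "nabla_grad x u = (k * \<phi> x) *\<^sub>R u"
proof (rule G_eqI[OF x])
  show "G x (nabla_grad x u) z = G x ((k * \<phi> x) *\<^sub>R u) z" for z
    unfolding G_nabla_grad[OF x] hess bilinear_lmul[OF bilinear_G[OF x]] by simp
qed

context
  fixes k
  assumes hess: "\<And>x u v. x \<in> S \<Longrightarrow> local_hessian G \<phi> x u v = k * \<phi> x * G x u v"
begin

text \<open>By metric compatibility the derivative of the squared gradient along \<open>h\<close> is
  twice the pairing of \<open>nabla_grad x h\<close> with \<open>grad x\<close>, that is 2 k \<phi>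
  d\<phi>(h), which is also the derivative of k \<phi>^2.\<close>

lemma has_derivative_grad_norm:
  assumes x: "x \<in> S"
  shows "((\<lambda>y. G y (grad y) (grad y) - k * (\<phi> y)\<^sup>2) has_derivative (\<lambda>h. 0)) (at x)"
proof -
  have d: "(\<phi> has_derivative dir_deriv \<phi> x) (at x)"
    using smooth_on_has_derivative[OF smooth_\<phi> x] .
  have "((\<lambda>y. G y (grad y) (grad y) - k * (\<phi> y)\<^sup>2) has_derivative
     (\<lambda>h. dir_deriv (\<lambda>y. G y (grad x) (grad x)) x h + G x (dir_deriv grad x h) (grad x)
        + G x (grad x) (dir_deriv grad x h) - k * (2 * \<phi> x * dir_deriv \<phi> x h))) (at x)"
    by (intro has_derivative_diff has_derivative_G[OF x] has_derivative_grad[OF x] has_derivative_mult_right)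
      (auto intro!: derivative_eq_intros d)
  moreover have "dir_deriv (\<lambda>y. G y (grad x) (grad x)) x h + G x (dir_deriv grad x h) (grad x)
        + G x (grad x) (dir_deriv grad x h) - k * (2 * \<phi> x * dir_deriv \<phi> x h) = 0" for h
  proof -
    have "G x (nabla_grad x h) (grad x) = k * \<phi> x * dir_deriv \<phi> x h"
      unfolding nabla_grad_eq[OF x hess[OF x]]
      by (simp add: bilinear_lmul[OF bilinear_G[OF x]] G_commute[OF x, of h] G_grad[OF x])
    then show ?thesis
      by (simp add: dir_deriv_G[OF x] bilinear_ladd[OF bilinear_G[OF x]] G_commute[OF x, of "grad x"])
  qed
  ultimately show ?thesis by simp
qed

lemma local_curvature_grad:
  assumes x: "x \<in> S"
  shows "local_curvature G x w u (grad x) = k *\<^sub>R (dir_deriv \<phi> x w *\<^sub>R u - dir_deriv \<phi> x u *\<^sub>R w)"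
proof -
  have d: "(\<phi> has_derivative dir_deriv \<phi> x) (at x)"
    using smooth_on_has_derivative[OF smooth_\<phi> x] .
  have grad_deriv: "dir_deriv grad y u = (k * \<phi> y) *\<^sub>R u - christoffel G y u (grad y)" if "y \<in> S" for y u
    using nabla_grad_eq[OF that hess[OF that], of u] by (simp add: algebra_simps)
  \<comment> \<open>The first-order equation for \<open>grad\<close> is differentiated once more,
    and the inner derivative of \<open>grad\<close> is eliminated by the same equation. The
    derivatives of \<open>christoffel\<close> that appear are those in
    \<open>local_curvature\<close>.\<close>
  have second: "dir_deriv (\<lambda>y. dir_deriv grad y u) x w
     = (k * dir_deriv \<phi> x w) *\<^sub>R u - dir_deriv (\<lambda>y. christoffel G y u (grad x)) x w
       - christoffel G x u ((k * \<phi> x) *\<^sub>R w - christoffel G x w (grad x))" for u w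
  proof -
    have "((\<lambda>y. (k * \<phi> y) *\<^sub>R u - christoffel G y u (grad y)) has_derivative
      (\<lambda>w. (k * dir_deriv \<phi> x w) *\<^sub>R u - (dir_deriv (\<lambda>y. christoffel G y u (grad x)) x w
       + christoffel G x 0 (grad x) + christoffel G x u (dir_deriv grad x w)))) (at x)"
      by (intro has_derivative_diff has_derivative_christoffel[OF x] has_derivative_grad[OF x]
          has_derivative_const has_derivative_scaleR_left has_derivative_mult_right d)
    from has_derivative_transform_within_open[OF this open_S x, of "\<lambda>y. dir_deriv grad y u"]
    show ?thesis
      using dir_deriv_eqI[of "\<lambda>y. dir_deriv grad y u"] grad_deriv 
      by (simp add: grad_deriv[OF x] bilinear_lzero[OF bilinear_christoffel[OF x]])
  qed
  \<comment> \<open>\<open>dir_deriv_commute\<close> concerns real functions, so it is applied to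
    the components of \<open>grad\<close>.\<close>
  have comm: "dir_deriv (\<lambda>y. dir_deriv grad y u) x w = dir_deriv (\<lambda>y. dir_deriv grad y w) x u"
  proof (rule euclidean_eqI)
    fix e :: 'a
    have c: "dir_deriv (\<lambda>y. h y \<bullet> e) y v = dir_deriv h y v \<bullet> e" if "y \<in> S" "smooth_on S h" for h :: "'a \<Rightarrow> 'a" and y v
      by (rule dir_deriv_eqI) (intro has_derivative_inner_left smooth_on_has_derivative[OF that(2,1)])
    have s: "smooth_on S (\<lambda>y. grad y \<bullet> e)"
      by (intro smooth_on_bounded_linear[OF open_S bounded_linear_inner_left] smooth_grad)
    have "dir_deriv (\<lambda>y. dir_deriv grad y u) x w \<bullet> e = dir_deriv (\<lambda>y. dir_deriv (\<lambda>y. grad y \<bullet> e) y u) x w" for u w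
      using c[OF _ smooth_grad] c[OF x smooth_on_dir_deriv[OF smooth_grad]]
       dir_deriv_cong_open[OF open_S _ x, of "\<lambda>y. dir_deriv (\<lambda>y. grad y \<bullet> e) y u" "\<lambda>y. dir_deriv grad y u \<bullet> e"]
      by simp
    then show "dir_deriv (\<lambda>y. dir_deriv grad y u) x w \<bullet> e = dir_deriv (\<lambda>y. dir_deriv grad y w) x u \<bullet> e"
      using dir_deriv_commute[OF open_S x s] by simp
  qed
  note b = bilinear_christoffel[OF x]
  show ?thesis
    using comm unfolding local_curvature_def second
    by (simp add: bilinear_rsub[OF b] bilinear_rmul[OF b] christoffel_commute[OF x, of u w]
        scaleR_diff_right algebra_simps)
qed

text \<open>The trace is over the first slot of the curvature. There the summand with
  \<open>u\<close> contributes d\<phi>(u) once, and the one with the identity contributes it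
  \<open>DIM('a)\<close> times with the opposite sign.\<close>

lemma local_ricci_grad:
  assumes x: "x \<in> S"
  shows "local_ricci G x u (grad x) = - ((real DIM('a) - 1) * k * dir_deriv \<phi> x u)"
proof -
  have "local_ricci G x u (grad x)
      = (\<Sum>e\<in>Basis. k * (dir_deriv \<phi> x e * (u \<bullet> e)) - k * dir_deriv \<phi> x u)"
    unfolding local_ricci_def local_curvature_grad[OF x]
    by (intro sum.cong) (auto simp: inner_diff_left algebra_simps)
  also have "\<dots> = k * (\<Sum>e\<in>Basis. (u \<bullet> e) *\<^sub>R dir_deriv \<phi> x e) - real DIM('a) * (k * dir_deriv \<phi> x u)"
    by (simp add: sum_subtractf sum_distrib_left mult.commute)
  also have "\<dots> = k * dir_deriv \<phi> x u - real DIM('a) * (k * dir_deriv \<phi> x u)"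
    using linear_eq_sum_Basis[OF linear_dir_deriv_\<phi>[OF x]] by metis
  finally show ?thesis by (simp add: algebra_simps)
qed

end

end

section \<open>Local curvature of warped products\<close>

text \<open>The warped metric at one point of a product chart, with the warping function reduced to
  a number \<open>c\<close>. Nondegeneracy and index thereby become questions about fixed bilinear
  forms.\<close>

definition warped_form :: "('a \<Rightarrow> 'a \<Rightarrow> real) \<Rightarrow> real \<Rightarrow> ('b \<Rightarrow> 'b \<Rightarrow> real) \<Rightarrow> 'a \<times> 'b \<Rightarrow> 'a \<times> 'b \<Rightarrow> real"
  where "warped_form b c b' u v = b (fst u) (fst v) + c\<^sup>2 * b' (snd u) (snd v)"

lemma scalar_product_warped_form:
  fixes b :: "'a::euclidean_space \<Rightarrow> 'a \<Rightarrow> real" and b' :: "'b::euclidean_space \<Rightarrow> 'b \<Rightarrow> real"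
  assumes b: "scalar_product b" and b': "scalar_product b'" and "c \<noteq> 0"
  shows "scalar_product (warped_form b c b')"
  unfolding scalar_product_def
proof (intro conjI allI impI)
  note bb = scalar_productD(1)[OF b] scalar_productD(1)[OF b']
  note s = bilinear_ladd[OF bb(1)] bilinear_ladd[OF bb(2)] bilinear_radd[OF bb(1)] bilinear_radd[OF bb(2)]
    bilinear_lmul[OF bb(1)] bilinear_lmul[OF bb(2)] bilinear_rmul[OF bb(1)] bilinear_rmul[OF bb(2)]
  show "bilinear (warped_form b c b')"
    unfolding bilinear_def by (auto intro!: linearI simp: warped_form_def s algebra_simps)
  show "warped_form b c b' u v = warped_form b c b' v u" for u v
    using scalar_productD(2)[OF b] scalar_productD(2)[OF b'] by (simp add: warped_form_def)
  fix u assume u: "\<forall>v. warped_form b c b' u v = 0"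
  have "b (fst u) v = 0" for v
    using u[rule_format, of "(v, 0)"] by (simp add: warped_form_def bilinear_rzero[OF bb(2)])
  moreover have "b' (snd u) v = 0" for v
    using u[rule_format, of "(0, v)"] \<open>c \<noteq> 0\<close> by (simp add: warped_form_def bilinear_rzero[OF bb(1)])
  ultimately show "u = 0"
    using b b' unfolding scalar_product_def by (simp add: prod_eq_iff)
qed

lemma sum_Basis_prod:
  "sum f (Basis :: ('a::euclidean_space \<times> 'b::euclidean_space) set)
    = (\<Sum>e\<in>Basis. f (e, 0)) + (\<Sum>e\<in>Basis. f (0, e))"
proof -
  have "inj_on (\<lambda>u. (u::'a, 0::'b)) Basis" "inj_on (\<lambda>u. (0::'a, u::'b)) Basis"
    by (auto intro!: inj_onI Pair_inject)
  then show ?thesis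
    unfolding Basis_prod_def by (subst sum.union_disjoint) (auto simp: sum.reindex)
qed

lemma smooth_on_fst:
  assumes "open S" "open T" "smooth_on S h"
  shows "smooth_on (S \<times> T) (\<lambda>z. h (fst z))"
  using smooth_on_affine_compose[OF open_Times[OF assms(1,2)] bounded_linear_fst, of 0 S h] assms(3) by auto

lemma smooth_on_snd:
  assumes "open S" "open T" "smooth_on T h"
  shows "smooth_on (S \<times> T) (\<lambda>z. h (snd z))"
  using smooth_on_affine_compose[OF open_Times[OF assms(1,2)] bounded_linear_snd, of 0 T h] assms(3) by auto

lemma has_derivative_fst_compose:
  assumes "(h has_derivative h') (at x)"
  shows "((\<lambda>z. h (fst z)) has_derivative (\<lambda>w. h' (fst w))) (at (x, y))"
  using diff_chain_at[OF bounded_linear_imp_has_derivative[OF bounded_linear_fst], of h h' "(x, y)"] assms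
  by (simp add: o_def)

lemma has_derivative_snd_compose:
  assumes "(h has_derivative h') (at y)"
  shows "((\<lambda>z. h (snd z)) has_derivative (\<lambda>w. h' (snd w))) (at (x, y))"
  using diff_chain_at[OF bounded_linear_imp_has_derivative[OF bounded_linear_snd], of h h' "(x, y)"] assms
  by (simp add: o_def)

locale local_warped_product = B: local_scalar_field SB GB \<phi> + F: local_semi_riemannian SF GF
  for SB :: "'a::euclidean_space set" and GB and \<phi> and SF :: "'b::euclidean_space set" and GF +
  assumes \<phi>_pos: "x \<in> SB \<Longrightarrow> \<phi> x > 0"
begin

abbreviation GW where "GW z \<equiv> warped_form (GB (fst z)) (\<phi> (fst z)) (GF (snd z))"

text \<open>The whole Levi-Civita calculus becomes available for the warped metric; in particular
  its Christoffel symbols can be identified by \<open>W.christoffel_eqI\<close>.\<close>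

sublocale W: local_semi_riemannian "SB \<times> SF" GW
proof
  show "open (SB \<times> SF)" by (intro open_Times B.open_S F.open_S)
  show "smooth_on (SB \<times> SF) (\<lambda>z. GW z u v)" for u v
    unfolding warped_form_def power2_eq_square
    using B.open_S F.open_S B.smooth_\<phi> B.smooth_G F.smooth_G
    by (intro smooth_on_add smooth_on_mult open_Times smooth_on_fst smooth_on_snd
        smooth_on_fst[where h = "\<lambda>x. GB x (fst u) (fst v)"] smooth_on_snd[where h = "\<lambda>y. GF y (snd u) (snd v)"])
  show "scalar_product (GW z)" if "z \<in> SB \<times> SF" for z
    using that \<phi>_pos[of "fst z"]
    by (intro scalar_product_warped_form B.scalar_product_G F.scalar_product_G) auto
qed

context
  fixes x y
  assumes x: "x \<in> SB" and y: "y \<in> SF"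
begin

lemma xy: "(x, y) \<in> SB \<times> SF" using x y by simp

lemmas GB_deriv = has_derivative_fst_compose[where y = y, OF has_derivative_dir_deriv[OF B.differentiable_G[OF x]]]
lemmas GF_deriv = has_derivative_snd_compose[where x = x, OF has_derivative_dir_deriv[OF F.differentiable_G[OF y]]]
lemmas \<phi>_deriv = has_derivative_fst_compose[where y = y, OF smooth_on_has_derivative[OF B.smooth_\<phi> x]]
lemmas d\<phi>_deriv = has_derivative_fst_compose[where y = y, OF smooth_on_has_derivative[OF smooth_on_dir_deriv[OF B.smooth_\<phi>] x]]
lemmas grad_deriv = has_derivative_fst_compose[where y = y, OF smooth_on_has_derivative[OF B.smooth_grad x]]
lemmas \<Gamma>B_deriv = has_derivative_fst_compose[where y = y, OF smooth_on_has_derivative[OF B.smooth_christoffel x]]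
lemmas \<Gamma>F_deriv = has_derivative_snd_compose[where x = x, OF smooth_on_has_derivative[OF F.smooth_christoffel y]]

lemma dir_deriv_GW:
  "dir_deriv (\<lambda>z. GW z u v) (x, y) w = dir_deriv (\<lambda>x. GB x (fst u) (fst v)) x (fst w)
    + (2 * \<phi> x * dir_deriv \<phi> x (fst w) * GF y (snd u) (snd v)
    + (\<phi> x)\<^sup>2 * dir_deriv (\<lambda>y. GF y (snd u) (snd v)) y (snd w))"
proof (rule dir_deriv_eqI)
  have "((\<lambda>z. (\<phi> (fst z))\<^sup>2) has_derivative (\<lambda>w. 2 * \<phi> x * dir_deriv \<phi> x (fst w))) (at (x, y))"
    by (auto intro!: derivative_eq_intros \<phi>_deriv)
  from has_derivative_add[OF GB_deriv has_derivative_mult[OF this GF_deriv]]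
  show "((\<lambda>z. GW z u v) has_derivative (\<lambda>w. dir_deriv (\<lambda>x. GB x (fst u) (fst v)) x (fst w)
    + (2 * \<phi> x * dir_deriv \<phi> x (fst w) * GF y (snd u) (snd v)
    + (\<phi> x)\<^sup>2 * dir_deriv (\<lambda>y. GF y (snd u) (snd v)) y (snd w)))) (at (x, y))"
    by (simp add: warped_form_def algebra_simps)
qed

text \<open>A value passes as the Christoffel symbol once its pairing with every \<open>t\<close>
  matches the Koszul expression, so the classical formula is just tested. Its three extra terms come
  from differentiating the factor \<phi>^2 in the directions \<open>t\<close>, \<open>u\<close> and
  \<open>v\<close> respectively.\<close>

lemma christoffel_GW_at:
  "christoffel GW (x, y) u v =
    (christoffel GB x (fst u) (fst v) - (\<phi> x * GF y (snd u) (snd v)) *\<^sub>R B.grad x,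
     christoffel GF y (snd u) (snd v) + (dir_deriv \<phi> x (fst u) / \<phi> x) *\<^sub>R snd v
       + (dir_deriv \<phi> x (fst v) / \<phi> x) *\<^sub>R snd u)"
proof (rule W.christoffel_eqI[OF xy])
  fix t
  note bb = B.bilinear_G[OF x] F.bilinear_G[OF y]
  have "\<phi> x \<noteq> 0" using \<phi>_pos[OF x] by simp
  then show "GW (x, y) (christoffel GB x (fst u) (fst v) - (\<phi> x * GF y (snd u) (snd v)) *\<^sub>R B.grad x,
     christoffel GF y (snd u) (snd v) + (dir_deriv \<phi> x (fst u) / \<phi> x) *\<^sub>R snd v
       + (dir_deriv \<phi> x (fst v) / \<phi> x) *\<^sub>R snd u) t = W.koszul (x, y) u v t"
    unfolding dir_deriv_GW
    by (simp add: warped_form_def bilinear_lsub[OF bb(1)] bilinear_lmul[OF bb(1)] bilinear_ladd[OF bb(2)]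
        bilinear_lmul[OF bb(2)] B.G_grad[OF x] B.G_christoffel[OF x] F.G_christoffel[OF y]
        power2_eq_square field_simps)
qed

end

text \<open>The formula as an identity of functions of \<open>z\<close> on the open product; in this
  form it may be differentiated.\<close>

lemma christoffel_GW:
  "z \<in> SB \<times> SF \<Longrightarrow> christoffel GW z u v =
    (christoffel GB (fst z) (fst u) (fst v) - (\<phi> (fst z) * GF (snd z) (snd u) (snd v)) *\<^sub>R B.grad (fst z),
     christoffel GF (snd z) (snd u) (snd v) + (dir_deriv \<phi> (fst z) (fst u) / \<phi> (fst z)) *\<^sub>R snd v
       + (dir_deriv \<phi> (fst z) (fst v) / \<phi> (fst z)) *\<^sub>R snd u)"
  using christoffel_GW_at[of "fst z" "snd z"] by (simp add: mem_Times_iff)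

context
  fixes x y
  assumes x: "x \<in> SB" and y: "y \<in> SF"
begin

lemma dir_deriv_christoffel_GW:
  "dir_deriv (\<lambda>z. christoffel GW z u v) (x, y) w =
    (dir_deriv (\<lambda>x. christoffel GB x (fst u) (fst v)) x (fst w)
      - ((\<phi> x * GF y (snd u) (snd v)) *\<^sub>R dir_deriv B.grad x (fst w)
        + (\<phi> x * dir_deriv (\<lambda>y. GF y (snd u) (snd v)) y (snd w)
          + dir_deriv \<phi> x (fst w) * GF y (snd u) (snd v)) *\<^sub>R B.grad x),
     dir_deriv (\<lambda>y. christoffel GF y (snd u) (snd v)) y (snd w)
      + (dir_deriv (\<lambda>x. dir_deriv \<phi> x (fst u)) x (fst w) / \<phi> x
         - dir_deriv \<phi> x (fst u) * dir_deriv \<phi> x (fst w) / (\<phi> x)\<^sup>2) *\<^sub>R snd v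
      + (dir_deriv (\<lambda>x. dir_deriv \<phi> x (fst v)) x (fst w) / \<phi> x
         - dir_deriv \<phi> x (fst v) * dir_deriv \<phi> x (fst w) / (\<phi> x)\<^sup>2) *\<^sub>R snd u)"
    (is "_ = (?D1 w, ?D2 w)")
proof (rule dir_deriv_eqI)
  have "\<phi> x \<noteq> 0" using \<phi>_pos[OF x] by simp
  have d\<theta>: "((\<lambda>z. dir_deriv \<phi> (fst z) a / \<phi> (fst z)) has_derivative
     (\<lambda>w. dir_deriv (\<lambda>x. dir_deriv \<phi> x a) x (fst w) / \<phi> x
       - dir_deriv \<phi> x a * dir_deriv \<phi> x (fst w) / (\<phi> x)\<^sup>2)) (at (x, y))" for a
    using has_derivative_divide'[OF d\<phi>_deriv[OF x y, of a] \<phi>_deriv[OF x y]] \<open>\<phi> x \<noteq> 0\<close>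
    by (simp add: power2_eq_square diff_divide_distrib)
  have "((\<lambda>z. christoffel GB (fst z) (fst u) (fst v)
      - (\<phi> (fst z) * GF (snd z) (snd u) (snd v)) *\<^sub>R B.grad (fst z)) has_derivative ?D1) (at (x, y))"
    using has_derivative_diff[OF \<Gamma>B_deriv[OF x y] 
        has_derivative_scaleR[OF has_derivative_mult[OF \<phi>_deriv[OF x y] GF_deriv[OF x y]] grad_deriv[OF x y]]]
    by simp
  moreover have "((\<lambda>z. christoffel GF (snd z) (snd u) (snd v) + (dir_deriv \<phi> (fst z) (fst u) / \<phi> (fst z)) *\<^sub>R snd v
       + (dir_deriv \<phi> (fst z) (fst v) / \<phi> (fst z)) *\<^sub>R snd u) has_derivative ?D2) (at (x, y))"
    by (intro has_derivative_add has_derivative_scaleR_left d\<theta> \<Gamma>F_deriv[OF x y])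
  ultimately have "((\<lambda>z. (christoffel GB (fst z) (fst u) (fst v) - (\<phi> (fst z) * GF (snd z) (snd u) (snd v)) *\<^sub>R B.grad (fst z),
     christoffel GF (snd z) (snd u) (snd v) + (dir_deriv \<phi> (fst z) (fst u) / \<phi> (fst z)) *\<^sub>R snd v
       + (dir_deriv \<phi> (fst z) (fst v) / \<phi> (fst z)) *\<^sub>R snd u)) has_derivative (\<lambda>w. (?D1 w, ?D2 w))) (at (x, y))"
    by (rule has_derivative_Pair)
  then show "((\<lambda>z. christoffel GW z u v) has_derivative (\<lambda>w. (?D1 w, ?D2 w))) (at (x, y))"
    by (rule has_derivative_transform_within_open[OF _ W.open_S xy[OF x y]]) (rule christoffel_GW[symmetric])
qed

text \<open>The Ricci trace over the product basis reads only the base component for base directions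
  and the fiber component for fiber directions. Here the terms d\<phi>(e) \<open>grad\<close> from
  differentiating \<phi> and from composing Christoffel symbols cancel, and the rest assembles to
  \<open>nabla_grad\<close>.\<close>

lemma fst_local_curvature_GW:
  "fst (local_curvature GW (x, y) (e, 0) v w) =
    local_curvature GB x e (fst v) (fst w) - (\<phi> x * GF y (snd v) (snd w)) *\<^sub>R B.nabla_grad x e"
proof -
  note [simp] = bilinear_lzero[OF F.bilinear_G[OF y]] bilinear_rmul[OF F.bilinear_G[OF y]]
    bilinear_rsub[OF B.bilinear_christoffel[OF x]] bilinear_rmul[OF B.bilinear_christoffel[OF x]]
    bilinear_lzero[OF F.bilinear_christoffel[OF y]] linear_0[OF B.linear_dir_deriv_\<phi>[OF x]]
    linear_0[OF linear_frechet_derivative[OF F.differentiable_G[OF y]]]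
    linear_0[OF F.linear_dir_deriv_G(2)[OF y]]
  have "\<phi> x \<noteq> 0" using \<phi>_pos[OF x] by simp
  then show ?thesis
    unfolding local_curvature_def dir_deriv_christoffel_GW christoffel_GW_at[OF x y]
    by (simp add: algebra_simps)
qed

text \<open>The products d\<phi> d\<phi> / \<phi>^2 cancel, so that differentiating d\<phi> / \<phi>
  leaves the Hessian over \<phi>. The squared gradient is d\<phi> applied to the \<open>grad\<close>
  component of the mixed Christoffel formula.\<close>

lemma snd_local_curvature_GW:
  "snd (local_curvature GW (x, y) (0, e) v w) =
    local_curvature GF y e (snd v) (snd w) - (local_hessian GB \<phi> x (fst v) (fst w) / \<phi> x) *\<^sub>R e
    - GB x (B.grad x) (B.grad x) *\<^sub>R (GF y (snd v) (snd w) *\<^sub>R e - GF y e (snd w) *\<^sub>R snd v)"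
proof -
  note \<Gamma> = bilinear_radd[OF F.bilinear_christoffel[OF y]] bilinear_rmul[OF F.bilinear_christoffel[OF y]]
    bilinear_lzero[OF B.bilinear_christoffel[OF x]] linear_0[OF B.linear_dir_deriv_\<phi>[OF x]]
    linear_diff[OF B.linear_dir_deriv_\<phi>[OF x]] linear_cmul[OF B.linear_dir_deriv_\<phi>[OF x]]
    linear_neg[OF B.linear_dir_deriv_\<phi>[OF x]]
    linear_0[OF linear_frechet_derivative[OF smooth_on_differentiable[OF smooth_on_dir_deriv[OF B.smooth_\<phi>] x]]]
    linear_0[OF linear_dir_deriv_field[OF B.open_S x B.linear_dir_deriv_\<phi>
        smooth_on_differentiable[OF smooth_on_dir_deriv[OF B.smooth_\<phi>] x]]]
    B.G_grad[OF x] F.christoffel_commute[OF y, of "snd v" e]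
  have "\<phi> x \<noteq> 0" using \<phi>_pos[OF x] by simp
  then show ?thesis
    unfolding local_curvature_def dir_deriv_christoffel_GW christoffel_GW_at[OF x y] local_hessian_def
    by (simp add: \<Gamma> algebra_simps power2_eq_square diff_divide_distrib)
qed

text \<open>The sum over \<open>nabla_grad\<close> is the Laplacian. The factor d - 1 is d copies of
  \<open>GF\<close> from the identity term minus one from contracting the rank-one term in
  \<open>snd v\<close>.\<close>

lemma local_ricci_GW:
  "local_ricci GW (x, y) v w = local_ricci GB x (fst v) (fst w) + local_ricci GF y (snd v) (snd w)
    - real DIM('b) / \<phi> x * local_hessian GB \<phi> x (fst v) (fst w)
    - (\<phi> x * (\<Sum>e\<in>Basis. B.nabla_grad x e \<bullet> e)
       + (real DIM('b) - 1) * GB x (B.grad x) (B.grad x)) * GF y (snd v) (snd w)"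
proof -
  have i: "a \<bullet> (e, 0) = fst a \<bullet> e" "a \<bullet> (0, e') = snd a \<bullet> e'" for a :: "'a \<times> 'b" and e e'
    by (simp_all add: inner_prod_def)
  have "(\<Sum>e\<in>Basis. local_curvature GW (x, y) (e, 0) v w \<bullet> (e, 0))
      = (\<Sum>e\<in>Basis. local_curvature GB x e (fst v) (fst w) \<bullet> e - (\<phi> x * GF y (snd v) (snd w)) * (B.nabla_grad x e \<bullet> e))"
    unfolding i fst_local_curvature_GW by (simp add: inner_diff_left del: fst_conv)
  also have "\<dots> = local_ricci GB x (fst v) (fst w) - (\<phi> x * GF y (snd v) (snd w)) * (\<Sum>e\<in>Basis. B.nabla_grad x e \<bullet> e)"
    by (simp add: local_ricci_def sum_subtractf sum_distrib_left)
  finally have 1: "(\<Sum>e\<in>Basis. local_curvature GW (x, y) (e, 0) v w \<bullet> (e, 0)) = \<dots>" .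
  let ?N = "GB x (B.grad x) (B.grad x)" and ?H = "local_hessian GB \<phi> x (fst v) (fst w)"
  have "(\<Sum>e\<in>Basis. local_curvature GW (x, y) (0, e) v w \<bullet> (0, e))
      = (\<Sum>e\<in>Basis. local_curvature GF y e (snd v) (snd w) \<bullet> e - ?H / \<phi> x
           - ?N * (GF y (snd v) (snd w) - (snd v \<bullet> e) *\<^sub>R GF y e (snd w)))"
    unfolding i snd_local_curvature_GW
    by (intro sum.cong) (simp_all add: inner_diff_left)
  also have "\<dots> = local_ricci GF y (snd v) (snd w) - real DIM('b) * (?H / \<phi> x)
      - ?N * (real DIM('b) * GF y (snd v) (snd w) - (\<Sum>e\<in>Basis. (snd v \<bullet> e) *\<^sub>R GF y e (snd w)))"
    by (simp add: local_ricci_def sum_subtractf flip: sum_distrib_left)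
  also have "\<dots> = local_ricci GF y (snd v) (snd w) - real DIM('b) * (?H / \<phi> x)
      - ?N * (real DIM('b) * GF y (snd v) (snd w) - GF y (snd v) (snd w))"
    using linear_eq_sum_Basis[OF scalar_productD(4)[OF F.scalar_product_G[OF y]], of "snd v" "snd w"]
    by simp
  finally have 2: "(\<Sum>e\<in>Basis. local_curvature GW (x, y) (0, e) v w \<bullet> (0, e)) = \<dots>" .
  show ?thesis
    unfolding local_ricci_def[of GW] sum_Basis_prod 1 2 by (simp add: algebra_simps)
qed

text \<open>Base vectors isolate the Hessian equation. Once it holds, the base blocks agree and the
  Laplacian is n k \<phi>, so the remaining discrepancy is a number times \<open>GF\<close>; the
  equation for \<mu>F says that this number is zero.\<close>

lemma local_ricci_GW_eq_iff:
  assumes RB: "\<And>u v. local_ricci GB x u v = \<mu>B * GB x u v"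
    and RF: "\<And>u v. local_ricci GF y u v = \<mu>F * GF y u v"
    and k: "k = (\<mu>B - \<mu>) / real DIM('b)"
  shows "(\<forall>u v. local_ricci GW (x, y) u v = \<mu> * GW (x, y) u v) \<longleftrightarrow>
    (\<forall>u v. local_hessian GB \<phi> x u v = k * \<phi> x * GB x u v) \<and>
    \<mu>F = (\<mu> + real DIM('a) * k) * (\<phi> x)\<^sup>2 + (real DIM('b) - 1) * GB x (B.grad x) (B.grad x)"
    (is "?L \<longleftrightarrow> ?H \<and> ?E")
proof -
  have \<phi>: "\<phi> x > 0" by (rule \<phi>_pos[OF x])
  have d: "real DIM('b) > 0" by simp
  have \<mu>: "\<mu> = \<mu>B - real DIM('b) * k" using k d by (simp add: field_simps)
  have H: ?H if L: ?L
  proof (intro allI)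
    fix u v
    have "\<mu>B * GB x u v - real DIM('b) / \<phi> x * local_hessian GB \<phi> x u v = \<mu> * GB x u v"
      using L[rule_format, of "(u, 0)" "(v, 0)"] unfolding local_ricci_GW RB RF
      by (simp add: warped_form_def bilinear_lzero[OF F.bilinear_G[OF y]])
    then have "real DIM('b) * local_hessian GB \<phi> x u v = real DIM('b) * (k * \<phi> x * GB x u v)"
      using \<phi> unfolding \<mu> by (simp add: field_simps)
    then show "local_hessian GB \<phi> x u v = k * \<phi> x * GB x u v"
      using d by (metis mult_left_cancel less_irrefl)
  qed
  have E: "?L \<longleftrightarrow> ?E" if H: ?H
  proof -
    have "(\<Sum>e\<in>Basis. B.nabla_grad x e \<bullet> e) = real DIM('a) * (k * \<phi> x)"
      unfolding B.nabla_grad_eq[OF x H[rule_format]] by simp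
    then have ric: "local_ricci GW (x, y) u v - \<mu> * GW (x, y) u v = (\<mu>F - ((\<mu> + real DIM('a) * k) * (\<phi> x)\<^sup>2
       + (real DIM('b) - 1) * GB x (B.grad x) (B.grad x))) * GF y (snd u) (snd v)" for u v
      using \<phi> unfolding local_ricci_GW RB RF H[rule_format] warped_form_def \<mu>
      by (simp add: field_simps power2_eq_square)
    \<comment> \<open>A pair on which \<open>GF y\<close> is nonzero, obtained from nondegeneracy,
      allows the scalar factor in \<open>ric\<close> to be read off.\<close>
    obtain e :: 'b where "e \<in> Basis" using nonempty_Basis by blast
    then obtain w where w: "GF y e w \<noteq> 0"
      using F.scalar_product_G[OF y] unfolding scalar_product_def by (metis nonzero_Basis)
    show ?thesis
    proof
      assume l: ?L
      show ?E using ric[of "(0, e)" "(0, w)"] w unfolding l[rule_format] by simp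
    next
      assume e: ?E
      show ?L
      proof (intro allI)
        show "local_ricci GW (x, y) u v = \<mu> * GW (x, y) u v" for u v
          using ric[of u v] unfolding e[symmetric] by simp
      qed
    qed
  qed
  show ?thesis using H E by blast
qed

end

end

section \<open>The index of a warped product\<close>

abbreviation negative_definite_on where
  "negative_definite_on b S \<equiv> subspace S \<and> (\<forall>u\<in>S. u \<noteq> 0 \<longrightarrow> b u u < (0::real))"

lemma finite_negative_dims:
  fixes b :: "'a::euclidean_space \<Rightarrow> 'a \<Rightarrow> real"
  shows "finite {dim S | S. negative_definite_on b S}"
  by (rule finite_subset[of _ "{..DIM('a)}"]) (auto intro: dim_subset_UNIV)

lemma dim_le_form_index: "negative_definite_on b S \<Longrightarrow> dim S \<le> form_index b"
  unfolding form_index_def by (rule Max_ge[OF finite_negative_dims]) blast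

lemma form_index_attained:
  fixes b :: "'a::euclidean_space \<Rightarrow> 'a \<Rightarrow> real"
  obtains S where "negative_definite_on b S" "dim S = form_index b"
proof -
  have "negative_definite_on b {0}" by (simp add: subspace_single_0)
  then have "{dim S | S. negative_definite_on b S} \<noteq> {}" by blast
  then have "form_index b \<in> {dim S | S. negative_definite_on b S}"
    unfolding form_index_def by (rule Max_in[OF finite_negative_dims])
  then show ?thesis using that by auto
qed

text \<open>The complement is orthogonal to a negative definite subspace of maximal dimension: a negative vector
  in it could be added to that subspace.\<close>

lemma nonnegative_complement:
  fixes b :: "'a::euclidean_space \<Rightarrow> 'a \<Rightarrow> real"
  assumes b: "scalar_product b"
  obtains P where "subspace P" "\<And>u. u \<in> P \<Longrightarrow> b u u \<ge> 0" "DIM('a) \<le> form_index b + dim P"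
proof -
  obtain S where S: "negative_definite_on b S" "dim S = form_index b" by (rule form_index_attained)
  define T where "T s = (\<Sum>e\<in>Basis. b s e *\<^sub>R e)" for s
  have T: "T s \<bullet> p = b s p" for s p
    using linear_eq_sum_Basis[OF scalar_productD(3)[OF b], of s p]
    unfolding inner_commute[of "T s"] by (simp add: T_def inner_sum_right mult.commute)
  have "linear T"
    by (intro linearI) (simp_all add: T_def scaleR_add_left sum.distrib scaleR_sum_right
        linear_add[OF scalar_productD(4)[OF b]] linear_cmul[OF scalar_productD(4)[OF b]])
  define P where "P = {p. \<forall>s\<in>S. b s p = 0}"
  have P: "P = {y \<in> UNIV. \<forall>x \<in> T ` S. orthogonal x y}"
    by (auto simp: P_def orthogonal_def T)
  have "dim P + dim (T ` S) = DIM('a)"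
    unfolding P using dim_subspace_orthogonal_to_vectors[OF linear_subspace_image[OF \<open>linear T\<close>] subspace_UNIV] S
    by simp
  moreover have "dim (T ` S) \<le> dim S" by (rule dim_image_le[OF \<open>linear T\<close>])
  ultimately have "DIM('a) \<le> form_index b + dim P" using S by simp
  moreover have "subspace P"
    unfolding P_def subspace_def using scalar_productD(3)[OF b] by (auto simp: linear_0 linear_add linear_cmul)
  moreover have "b p p \<ge> 0" if p: "p \<in> P" for p
  proof (rule ccontr)
    assume "\<not> b p p \<ge> 0"
    have "b u u < 0" if u: "u \<in> span (insert p S)" "u \<noteq> 0" for u
    proof -
      obtain r where "u - r *\<^sub>R p \<in> span S" using u by (auto simp: span_breakdown_eq)
      then have s: "u - r *\<^sub>R p \<in> S" (is "?s \<in> S") using S span_eq_iff by blast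
      have "b ?s p = 0" "b p ?s = 0" using s p scalar_productD(2)[OF b, of p ?s] by (auto simp: P_def)
      moreover have "b u u = b (?s + r *\<^sub>R p) (?s + r *\<^sub>R p)" by simp
      ultimately have eq: "b u u = b ?s ?s + r * r * b p p"
        unfolding bilinear_ladd[OF scalar_productD(1)[OF b]] bilinear_radd[OF scalar_productD(1)[OF b]]
          bilinear_lmul[OF scalar_productD(1)[OF b]] bilinear_rmul[OF scalar_productD(1)[OF b]] by simp
      show ?thesis
      proof (cases "r = 0")
        case True
        then show ?thesis using S(1) s u(2) by simp
      next
        case False
        then have "r * r * b p p < 0"
          using \<open>\<not> b p p \<ge> 0\<close> by (intro mult_pos_neg) (auto simp: zero_less_mult_iff)
        moreover have "b ?s ?s \<le> 0"
          using S(1) s bilinear_lzero[OF scalar_productD(1)[OF b]] by (cases "?s = 0") (auto intro: less_imp_le)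
        ultimately show ?thesis unfolding eq by simp
      qed
    qed
    then have "dim (span (insert p S)) \<le> form_index b"
      by (intro dim_le_form_index) (auto simp: subspace_span)
    moreover have "p \<notin> span S"
    proof
      assume "p \<in> span S"
      then have "b p p = 0" using S(1) p span_eq_iff unfolding P_def by blast
      then show False using \<open>\<not> b p p \<ge> 0\<close> by simp
    qed
    ultimately show False using S(2) by (simp add: dim_insert)
  qed
  ultimately show ?thesis using that by blast
qed

text \<open>Upper bound: a negative definite subspace meets the product of the two nonnegative
  complements only in 0, which limits its dimension. Lower bound: the product of maximal negative
  definite subspaces is negative definite, as c^2 > 0.\<close>

lemma form_index_warped_form:
  fixes b :: "'a::euclidean_space \<Rightarrow> 'a \<Rightarrow> real" and b' :: "'b::euclidean_space \<Rightarrow> 'b \<Rightarrow> real"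
  assumes b: "scalar_product b" and b': "scalar_product b'" and c: "c \<noteq> 0"
  shows "form_index (warped_form b c b') = form_index b + form_index b'"
proof (rule antisym)
  obtain P where P: "subspace P" "\<And>u. u \<in> P \<Longrightarrow> b u u \<ge> 0" "DIM('a) \<le> form_index b + dim P"
    using nonnegative_complement[OF b] by blast
  obtain P' where P': "subspace P'" "\<And>u. u \<in> P' \<Longrightarrow> b' u u \<ge> 0" "DIM('b) \<le> form_index b' + dim P'"
    using nonnegative_complement[OF b'] by blast
  obtain S where S: "negative_definite_on (warped_form b c b') S" "dim S = form_index (warped_form b c b')"
    by (rule form_index_attained)
  have "warped_form b c b' u u \<ge> 0" if "u \<in> P \<times> P'" for u
    using that P(2) P'(2) by (auto simp: warped_form_def)
  then have "S \<inter> (P \<times> P') \<subseteq> {0}" using S(1) by force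
  then have "dim (S \<inter> (P \<times> P')) = 0" by (simp add: dim_eq_0)
  moreover have "subspace (P \<times> P')" using P(1) P'(1) by (rule subspace_Times)
  ultimately have "dim S + dim (P \<times> P') \<le> DIM('a \<times> 'b)"
    using dim_sums_Int[OF S(1)[THEN conjunct1], of "P \<times> P'"]
      dim_subset_UNIV[of "{x + y |x y. x \<in> S \<and> y \<in> P \<times> P'}"]
    by linarith
  then show "form_index (warped_form b c b') \<le> form_index b + form_index b'"
    using P P' S dim_Times[OF P(1) P'(1)] by simp
next
  obtain S where S: "negative_definite_on b S" "dim S = form_index b" by (rule form_index_attained)
  obtain S' where S': "negative_definite_on b' S'" "dim S' = form_index b'" by (rule form_index_attained)
  have "warped_form b c b' u u < 0" if u: "u \<in> S \<times> S'" "u \<noteq> 0" for u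
  proof -
    have "b (fst u) (fst u) \<le> 0" "b' (snd u) (snd u) \<le> 0"
      using u(1) S(1) S'(1) bilinear_lzero[OF scalar_productD(1)[OF b]] bilinear_lzero[OF scalar_productD(1)[OF b']]
      by (cases "fst u = 0"; cases "snd u = 0"; force)+
    moreover have "b (fst u) (fst u) < 0 \<or> b' (snd u) (snd u) < 0"
      using u S(1) S'(1) by (auto simp: prod_eq_iff mem_Times_iff)
    moreover have "c\<^sup>2 > 0" using c by simp
    ultimately show ?thesis
      unfolding warped_form_def by (smt (verit) mult_nonneg_nonpos mult_pos_neg)
  qed
  then have "negative_definite_on (warped_form b c b') (S \<times> S')"
    using S(1) S'(1) subspace_Times by blast
  then have "dim (S \<times> S') \<le> form_index (warped_form b c b')" by (rule dim_le_form_index)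
  then show "form_index b + form_index b' \<le> form_index (warped_form b c b')"
    using S S' dim_Times[of S S'] by simp
qed

section \<open>Charts and tangent vectors\<close>

lemma chart_inv_chart [simp]: "is_chart c \<Longrightarrow> p \<in> fst c \<Longrightarrow> chart_inv c (snd c p) = p"
  unfolding is_chart_def homeomorphism_def by blast

lemma chart_chart_inv [simp]: "x \<in> snd c ` fst c \<Longrightarrow> snd c (chart_inv c x) = x"
  unfolding chart_inv_def by (rule f_inv_into_f)

lemma chart_inv_in [simp]: "x \<in> snd c ` fst c \<Longrightarrow> chart_inv c x \<in> fst c"
  unfolding chart_inv_def by (rule inv_into_into)

lemma open_chart_image:
  assumes "is_chart c" "open W"
  shows "open (snd c ` (fst c \<inter> W))"
proof -
  have "openin (top_of_set (snd c ` fst c)) (snd c ` (fst c \<inter> W))"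
    using assms homeomorphism_imp_open_map[of "fst c" "snd c ` fst c" "snd c" "chart_inv c" "fst c \<inter> W"]
    unfolding is_chart_def by (simp add: openin_open_Int)
  then show ?thesis using assms(1) openin_open_trans unfolding is_chart_def by blast
qed

lemma smooth_atlasD:
  assumes "smooth_atlas A" "c \<in> A"
  shows "is_chart c" "open (fst c)" "open (snd c ` fst c)"
  using assms unfolding smooth_atlas_def is_chart_def by auto

lemma charts_atD: "c \<in> charts_at A p \<Longrightarrow> c \<in> A" "c \<in> charts_at A p \<Longrightarrow> p \<in> fst c"
  by (auto simp: charts_at_def)

lemma charts_at_nonempty:
  assumes "smooth_atlas A"
  obtains c where "c \<in> charts_at A p"
  using assms unfolding smooth_atlas_def charts_at_def by (metis (mono_tags, lifting) UNIV_I UN_E mem_Collect_eq)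

lemma charts_at_chart_inv: "c \<in> A \<Longrightarrow> x \<in> snd c ` fst c \<Longrightarrow> c \<in> charts_at A (chart_inv c x)"
  by (simp add: charts_at_def)

lemma smooth_near_differentiable:
  assumes "smooth_atlas A" "c \<in> charts_at A p" "smooth_near A p h"
  shows "(h \<circ> chart_inv c) differentiable (at (snd c p))"
  using assms unfolding smooth_near_def smooth_fun_on_def charts_at_def
  by (force intro: smooth_on_differentiable)

text \<open>Chart coordinates are admissible test functions, although they are meaningful only on
  the chart domain. They serve to separate tangent vectors.\<close>

lemma smooth_near_chart_inner:
  assumes A: "smooth_atlas A" and c: "c \<in> charts_at A p"
  shows "smooth_near A p (\<lambda>q. snd c q \<bullet> w)"
  unfolding smooth_near_def
proof (intro exI conjI)
  show "open (fst c)" "p \<in> fst c" using smooth_atlasD[OF A] c by (auto simp: charts_at_def)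
  show "smooth_fun_on A (fst c) (\<lambda>q. snd c q \<bullet> w)"
    unfolding smooth_fun_on_def
  proof
    fix c' assume c': "c' \<in> A"
    have "smooth_on (snd c' ` (fst c' \<inter> fst c)) (snd c \<circ> chart_inv c')"
      using A c c' by (auto simp: smooth_atlas_def charts_at_def)
    then have "smooth_on (snd c' ` (fst c' \<inter> fst c)) (\<lambda>x. (snd c \<circ> chart_inv c') x \<bullet> w)"
      by (rule smooth_on_bounded_linear[OF open_chart_image[OF smooth_atlasD(1)[OF A c'] \<open>open (fst c)\<close>]
            bounded_linear_inner_left])
    then show "smooth_on (snd c' ` (fst c' \<inter> fst c)) ((\<lambda>q. snd c q \<bullet> w) \<circ> chart_inv c')"
      by (simp add: o_def)
  qed
qed

text \<open>The chain rule along the transition map. It allows \<open>tangent_space\<close>, defined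
  with all charts at once, to be described by a single one.\<close>

lemma coord_vector_change:
  assumes A: "smooth_atlas A" and c: "c \<in> charts_at A p" and c': "c' \<in> charts_at A p"
  shows "coord_vector A c p u = coord_vector A c' p (dir_deriv (snd c' \<circ> chart_inv c) (snd c p) u)"
proof
  fix h
  show "coord_vector A c p u h = coord_vector A c' p (dir_deriv (snd c' \<circ> chart_inv c) (snd c p) u) h"
  proof (cases "smooth_near A p h")
    case True
    note cA = charts_atD[OF c] charts_atD[OF c']
    let ?U = "snd c ` (fst c \<inter> fst c')"
    have U: "open ?U" "snd c p \<in> ?U"
      using open_chart_image[OF smooth_atlasD(1)[OF A cA(1)] smooth_atlasD(2)[OF A cA(3)]] cA by auto
    have "((snd c' \<circ> chart_inv c) has_derivative dir_deriv (snd c' \<circ> chart_inv c) (snd c p)) (at (snd c p))"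
      using A cA U(2) by (intro smooth_on_has_derivative[of ?U]) (auto simp: smooth_atlas_def)
    moreover have "(snd c' \<circ> chart_inv c) (snd c p) = snd c' p"
      using cA smooth_atlasD[OF A] by simp
    ultimately have "(((h \<circ> chart_inv c') \<circ> (snd c' \<circ> chart_inv c)) has_derivative
        dir_deriv (h \<circ> chart_inv c') (snd c' p) \<circ> dir_deriv (snd c' \<circ> chart_inv c) (snd c p)) (at (snd c p))"
      using has_derivative_dir_deriv[OF smooth_near_differentiable[OF A c' True]] by (intro diff_chain_at) auto
    then have "((h \<circ> chart_inv c) has_derivative
        dir_deriv (h \<circ> chart_inv c') (snd c' p) \<circ> dir_deriv (snd c' \<circ> chart_inv c) (snd c p)) (at (snd c p))"
      by (rule has_derivative_transform_within_open[OF _ U]) (use smooth_atlasD(1)[OF A cA(1)] smooth_atlasD(1)[OF A cA(3)] in auto)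
    from dir_deriv_eqI[OF this] show ?thesis using True by (simp add: coord_vector_def)
  qed (simp add: coord_vector_def)
qed

lemma tangent_space_eq:
  assumes "smooth_atlas A" "c \<in> charts_at A p"
  shows "tangent_space A p = range (coord_vector A c p)"
  using coord_vector_change[OF assms(1) _ assms(2)] assms(2) unfolding tangent_space_def by blast

text \<open>On the coordinate function \<open>\<lambda>q. snd c q \<bullet> w\<close> the vector
  with components \<open>z\<close> takes the value \<open>z \<bullet> w\<close>, which recovers
  \<open>z\<close>. This makes the description in \<open>components\<close> well defined.\<close>

lemma coord_vector_inject:
  assumes A: "smooth_atlas A" and c: "c \<in> charts_at A p"
  shows "coord_vector A c p u = coord_vector A c p v \<longleftrightarrow> u = v"
proof
  assume eq: "coord_vector A c p u = coord_vector A c p v"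
  have "coord_vector A c p z (\<lambda>q. snd c q \<bullet> w) = z \<bullet> w" for z w
  proof -
    have "((\<lambda>x. x \<bullet> w) has_derivative (\<lambda>z. z \<bullet> w)) (at (snd c p))"
      by (intro bounded_linear_imp_has_derivative bounded_linear_inner_left)
    then have "((\<lambda>q. snd c q \<bullet> w) \<circ> chart_inv c has_derivative (\<lambda>z. z \<bullet> w)) (at (snd c p))"
      by (rule has_derivative_transform_within_open[OF _ smooth_atlasD(3)[OF A charts_atD(1)[OF c]]])
        (use charts_atD[OF c] in auto)
    from dir_deriv_eqI[OF this] show ?thesis
      using smooth_near_chart_inner[OF A c] by (simp add: coord_vector_def)
  qed
  then have "u \<bullet> w = v \<bullet> w" for w using eq by metis
  then show "u = v" by (metis vector_eq_ldot inner_commute)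
qed simp

lemma components_coord_vector [simp]:
  assumes "smooth_atlas A" "c \<in> charts_at A p"
  shows "components A c p (coord_vector A c p u) = u"
  unfolding components_def coord_vector_inject[OF assms] by simp

section \<open>Einstein equation, Hessian and gradient expressed in charts\<close>

lemma local_metric_chart:
  assumes "smooth_atlas A" "c \<in> charts_at A p"
  shows "local_metric A g c (snd c p) u v = g p (coord_vector A c p u) (coord_vector A c p v)"
  using smooth_atlasD[OF assms(1)] charts_atD[OF assms(2)] by (simp add: local_metric_def)

lemma ball_charts_at_iff:
  assumes "smooth_atlas A"
  shows "(\<forall>p. \<forall>c\<in>charts_at A p. P c p) \<longleftrightarrow> (\<forall>c\<in>A. \<forall>x\<in>snd c ` fst c. P c (chart_inv c x))"
  using smooth_atlasD[OF assms] by (auto simp: charts_at_def)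

text \<open>In a chart the tangent vectors are parametrized bijectively by their components, so the
  quantifiers over \<open>tangent_space\<close> become quantifiers over the model space, and points
  with a chart become points of chart images.\<close>

lemma einstein_iff_local:
  "einstein A g \<mu> \<longleftrightarrow> semi_riemannian A g \<and>
    (\<forall>c\<in>A. \<forall>x\<in>snd c ` fst c. \<forall>u v.
      local_ricci (local_metric A g c) x u v = \<mu> * local_metric A g c x u v)"
proof (cases "semi_riemannian A g")
  case True
  then have A: "smooth_atlas A" by (simp add: semi_riemannian_def)
  have "(\<forall>X\<in>tangent_space A p. \<forall>Y\<in>tangent_space A p. ricci A g c p X Y = \<mu> * g p X Y) \<longleftrightarrow>
    (\<forall>u v. local_ricci (local_metric A g c) (snd c p) u v = \<mu> * local_metric A g c (snd c p) u v)"
    if c: "c \<in> charts_at A p" for c p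
    unfolding tangent_space_eq[OF A c] ricci_def local_metric_chart[OF A c]
    by (simp add: components_coord_vector[OF A c])
  then show ?thesis
    using True ball_charts_at_iff[OF A, of "\<lambda>c p. \<forall>u v. local_ricci (local_metric A g c) (snd c p) u v = \<mu> * local_metric A g c (snd c p) u v"]
    unfolding einstein_def by simp
qed (simp add: einstein_def)

lemma hessian_eq_iff_local:
  assumes A: "smooth_atlas A"
  shows "(\<forall>p. \<forall>c\<in>charts_at A p. \<forall>X\<in>tangent_space A p. \<forall>Y\<in>tangent_space A p.
      hessian A g f c p X Y = \<kappa> p * g p X Y) \<longleftrightarrow>
    (\<forall>c\<in>A. \<forall>x\<in>snd c ` fst c. \<forall>u v.
      local_hessian (local_metric A g c) (f \<circ> chart_inv c) x u v = \<kappa> (chart_inv c x) * local_metric A g c x u v)"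
proof -
  have "(\<forall>X\<in>tangent_space A p. \<forall>Y\<in>tangent_space A p. hessian A g f c p X Y = \<kappa> p * g p X Y) \<longleftrightarrow>
    (\<forall>u v. local_hessian (local_metric A g c) (f \<circ> chart_inv c) (snd c p) u v = \<kappa> p * local_metric A g c (snd c p) u v)"
    if c: "c \<in> charts_at A p" for c p
    unfolding tangent_space_eq[OF A c] hessian_def local_metric_chart[OF A c]
    by (simp add: components_coord_vector[OF A c])
  then show ?thesis
    using ball_charts_at_iff[OF A, of "\<lambda>c p. \<forall>u v. local_hessian (local_metric A g c) (f \<circ> chart_inv c) (snd c p) u v = \<kappa> p * local_metric A g c (snd c p) u v"]
    by simp
qed

lemma local_semi_riemannian_chart:
  assumes "semi_riemannian A g" "c \<in> A"
  shows "local_semi_riemannian (snd c ` fst c) (local_metric A g c)"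
  using assms smooth_atlasD(3)[OF _ assms(2)] by unfold_locales (auto simp: semi_riemannian_def)

lemma local_scalar_field_chart:
  assumes "semi_riemannian A g" "c \<in> A" "smooth_fun_on A UNIV f"
  shows "local_scalar_field (snd c ` fst c) (local_metric A g c) (f \<circ> chart_inv c)"
  using assms(2,3)
  by (intro local_scalar_field.intro local_semi_riemannian_chart[OF assms(1,2)]
      local_scalar_field_axioms.intro) (auto simp: smooth_fun_on_def)

lemma gradient_chart:
  assumes g: "semi_riemannian A g" and c: "c \<in> charts_at A p" and f: "smooth_fun_on A UNIV f"
  defines "G \<equiv> local_metric A g c"
  shows "gradient A g f p
    = coord_vector A c p (sharp (G (snd c p)) (dir_deriv (f \<circ> chart_inv c) (snd c p)))"
proof -
  have A: "smooth_atlas A" using g by (simp add: semi_riemannian_def)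
  interpret local_scalar_field "snd c ` fst c" G "f \<circ> chart_inv c"
    unfolding G_def using local_scalar_field_chart[OF g charts_atD(1)[OF c] f] .
  have x: "snd c p \<in> snd c ` fst c" using charts_atD[OF c] by simp
  have f': "smooth_near A p f" using f by (auto simp: smooth_near_def)
  have "(\<forall>Y\<in>tangent_space A p. g p (coord_vector A c p u) Y = Y f) \<longleftrightarrow> u = grad (snd c p)" for u
  proof -
    have "(\<forall>Y\<in>tangent_space A p. g p (coord_vector A c p u) Y = Y f) \<longleftrightarrow>
      (\<forall>v. G (snd c p) u v = dir_deriv (f \<circ> chart_inv c) (snd c p) v)"
      using f' unfolding tangent_space_eq[OF A c] G_def local_metric_chart[OF A c]
      by (simp add: coord_vector_def)
    also have "\<dots> \<longleftrightarrow> u = grad (snd c p)"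
      using G_grad[OF x] G_eqI[OF x] by metis
    finally show ?thesis .
  qed
  then show ?thesis
    unfolding gradient_def using tangent_space_eq[OF A c] by (intro the_equality) auto
qed

lemma metric_gradient_chart:
  assumes g: "semi_riemannian A g" and c: "c \<in> charts_at A p" and f: "smooth_fun_on A UNIV f"
  defines "N \<equiv> sharp (local_metric A g c (snd c p)) (dir_deriv (f \<circ> chart_inv c) (snd c p))"
  shows "g p (gradient A g f p) (gradient A g f p) = local_metric A g c (snd c p) N N"
proof -
  have A: "smooth_atlas A" using g by (simp add: semi_riemannian_def)
  show ?thesis unfolding N_def gradient_chart[OF g c f] local_metric_chart[OF A c] ..
qed

text \<open>Raising an index in Ric = \<mu> g gives \<mu> times the identity, whose trace brings in
  the dimension; the normalized value is then \<mu> / (n - 1).\<close>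

lemma scalar_curvature_einstein:
  assumes e: "einstein (A :: ('p::{t2_space, second_countable_topology}, 'a::euclidean_space) chart set) g \<mu>"
    and c: "c \<in> charts_at A p"
  shows "scalar_curvature A g c p = real DIM('a) * \<mu>"
proof -
  have "semi_riemannian A g" using e by (simp add: einstein_def)
  then interpret local_semi_riemannian "snd c ` fst c" "local_metric A g c"
    using local_semi_riemannian_chart charts_atD[OF c] by blast
  have x: "snd c p \<in> snd c ` fst c" using charts_atD[OF c] by simp
  have "sharp (local_metric A g c (snd c p)) (local_ricci (local_metric A g c) (snd c p) b) = \<mu> *\<^sub>R b" for b
  proof (rule sharp_eqI[OF scalar_product_G[OF x]])
    have "local_ricci (local_metric A g c) (snd c p) b z = \<mu> * local_metric A g c (snd c p) b z" for z
      using e charts_atD(1)[OF c] x unfolding einstein_iff_local by blast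
    then show "local_metric A g c (snd c p) (\<mu> *\<^sub>R b) z = local_ricci (local_metric A g c) (snd c p) b z" for z
      by (simp add: bilinear_lmul[OF bilinear_G[OF x]])
  qed
  then show ?thesis
    unfolding scalar_curvature_def local_scalar_curvature_def by simp
qed

text \<open>Zero derivative gives constancy on a convex ball in a chart, hence local constancy, and
  connectedness does the rest. It is also used contrapositively: a nonconstant \<open>f\<close> has
  a nonzero derivative somewhere.\<close>

lemma constant_if_derivative_zero:
  assumes A: "smooth_atlas (A :: ('p::{t2_space, second_countable_topology}, 'a::euclidean_space) chart set)"
    and conn: "connected (UNIV :: 'p set)"
    and h: "\<And>c x. c \<in> A \<Longrightarrow> x \<in> snd c ` fst c \<Longrightarrow>
      ((h \<circ> chart_inv c :: 'a \<Rightarrow> real) has_derivative (\<lambda>_. 0)) (at x)"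
  shows "h constant_on UNIV"
proof (rule locally_constant_imp_constant[OF conn])
  fix p :: 'p
  obtain c where c: "c \<in> charts_at A p" using charts_at_nonempty[OF A] .
  note ch = smooth_atlasD[OF A charts_atD(1)[OF c]]
  obtain e where e: "e > 0" "ball (snd c p) e \<subseteq> snd c ` fst c"
    using ch(3) charts_atD[OF c] by (meson imageI openE)
  obtain k where k: "\<And>x. x \<in> ball (snd c p) e \<Longrightarrow> (h \<circ> chart_inv c) x = k"
    using has_derivative_zero_constant[of "ball (snd c p) e" "h \<circ> chart_inv c"]
      h[OF charts_atD(1)[OF c]] e(2) has_derivative_at_withinI
    by (metis (no_types, lifting) convex_ball subsetD)
  let ?T = "fst c \<inter> snd c -` ball (snd c p) e"
  have "h q = k" if "q \<in> ?T" for q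
    using k[of "snd c q"] that ch by auto
  moreover have "open ?T"
    using ch by (intro continuous_open_preimage) (auto simp: is_chart_def homeomorphism_def)
  moreover have "p \<in> ?T" using charts_atD[OF c] e by simp
  ultimately show "\<exists>T. openin (top_of_set UNIV) T \<and> p \<in> T \<and> (\<forall>x\<in>T. h x = h p)"
    by (intro exI[of _ ?T]) auto
qed

section \<open>Product atlases\<close>

lemma fst_product_chart [simp]: "fst (product_chart c c') = fst c \<times> fst c'"
  and snd_product_chart [simp]: "snd (product_chart c c') = map_prod (snd c) (snd c')"
  by (simp_all add: product_chart_def)

lemma map_prod_image_Times: "map_prod g h ` (A \<times> B) = g ` A \<times> h ` B"
  by force

text \<open>Restricted to the chart image, because \<open>inv_into\<close> is arbitrary outside;
  statements about derivatives and smoothness in product charts are transferred along this identity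
  on open sets.\<close>

lemma chart_inv_product_chart:
  assumes "is_chart c" "is_chart c'" "z \<in> snd c ` fst c \<times> snd c' ` fst c'"
  shows "chart_inv (product_chart c c') z = (chart_inv c (fst z), chart_inv c' (snd z))"
proof -
  have "inj_on (snd c) (fst c)" "inj_on (snd c') (fst c')"
    using assms chart_inv_chart inj_on_inverseI by metis+
  then have "inj_on (map_prod (snd c) (snd c')) (fst c \<times> fst c')" by (rule map_prod_inj_on)
  then show ?thesis
    unfolding chart_inv_def[of "product_chart c c'"] using assms
    by (intro inv_into_f_eq) (auto simp: mem_Times_iff)
qed

lemma is_chart_product_chart:
  assumes c: "is_chart c" and c': "is_chart c'"
  shows "is_chart (product_chart c c')"
proof -
  let ?k = "\<lambda>z. (chart_inv c (fst z), chart_inv c' (snd z))"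
  have h: "homeomorphism (fst c) (snd c ` fst c) (snd c) (chart_inv c)"
    "homeomorphism (fst c') (snd c' ` fst c') (snd c') (chart_inv c')"
    and o: "open (fst c)" "open (fst c')" "open (snd c ` fst c)" "open (snd c' ` fst c')"
    using c c' by (auto simp: is_chart_def)
  have cont: "continuous_on (fst c) (snd c)" "continuous_on (fst c') (snd c')"
    "continuous_on (snd c ` fst c) (chart_inv c)" "continuous_on (snd c' ` fst c') (chart_inv c')"
    using h by (auto simp: homeomorphism_def)
  have 1: "continuous_on (fst c \<times> fst c') (map_prod (snd c) (snd c'))"
    unfolding map_prod_def case_prod_beta
    by (intro continuous_on_Pair continuous_on_compose2[OF cont(1)] continuous_on_compose2[OF cont(2)]
        continuous_on_fst continuous_on_snd continuous_on_id) auto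
  have "continuous_on (snd c ` fst c \<times> snd c' ` fst c') ?k"
    by (intro continuous_on_Pair continuous_on_compose2[OF cont(3)] continuous_on_compose2[OF cont(4)]
        continuous_on_fst continuous_on_snd continuous_on_id) auto
  then have 2: "continuous_on (snd c ` fst c \<times> snd c' ` fst c') (chart_inv (product_chart c c'))"
    using chart_inv_product_chart[OF c c'] by (simp cong: continuous_on_cong)
  have "chart_inv (product_chart c c') ` (snd c ` fst c \<times> snd c' ` fst c') = fst c \<times> fst c'"
  proof -
    have "chart_inv (product_chart c c') ` (snd c ` fst c \<times> snd c' ` fst c')
        = ?k ` (snd c ` fst c \<times> snd c' ` fst c')"
      using chart_inv_product_chart[OF c c'] by (intro image_cong) auto
    also have "\<dots> = (chart_inv c ` snd c ` fst c) \<times> (chart_inv c' ` snd c' ` fst c')" by force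
    also have "\<dots> = fst c \<times> fst c'" using h by (simp add: homeomorphism_def)
    finally show ?thesis .
  qed
  then show ?thesis
    unfolding is_chart_def homeomorphism_def fst_product_chart snd_product_chart map_prod_image_Times
    using 1 2 o c c' chart_inv_product_chart[OF c c']
    by (auto intro: open_Times simp: map_prod_image_Times)
qed

lemma product_chart_in_product_atlas: "c \<in> B \<Longrightarrow> c' \<in> F \<Longrightarrow> product_chart c c' \<in> product_atlas B F"
  unfolding product_atlas_def by blast

lemma ball_product_atlas_iff:
  "(\<forall>d\<in>product_atlas B F. P d) \<longleftrightarrow> (\<forall>c\<in>B. \<forall>c'\<in>F. P (product_chart c c'))"
  unfolding product_atlas_def by blast

lemma product_atlas_cases:
  assumes "d \<in> product_atlas B F"
  obtains c c' where "d = product_chart c c'" "c \<in> B" "c' \<in> F"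
  using assms unfolding product_atlas_def by blast

lemma smooth_on_Pair:
  assumes "open S" "smooth_on S h" "smooth_on S h'"
  shows "smooth_on S (\<lambda>x. (h x, h' x))"
proof -
  have L: "bounded_linear (\<lambda>u. (u, 0))" "bounded_linear (\<lambda>v. (0, v))"
    by (intro bounded_linear_Pair bounded_linear_ident bounded_linear_zero)+
  have "smooth_on S (\<lambda>x. (h x, 0) + (0, h' x))"
    by (intro smooth_on_add[OF assms(1)] smooth_on_bounded_linear[OF assms(1) L(1) assms(2)]
        smooth_on_bounded_linear[OF assms(1) L(2) assms(3)])
  then show ?thesis by simp
qed

lemma smooth_atlas_product:
  assumes B: "smooth_atlas B" and F: "smooth_atlas F"
  shows "smooth_atlas (product_atlas B F)"
  unfolding smooth_atlas_def
proof (intro conjI ballI)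
  show "is_chart d" if "d \<in> product_atlas B F" for d
    using that smooth_atlasD(1)[OF B] smooth_atlasD(1)[OF F] is_chart_product_chart
    by (elim product_atlas_cases) blast
  have "\<exists>d\<in>product_atlas B F. (p, q) \<in> fst d" for p q
  proof -
    obtain c c' where c: "c \<in> charts_at B p" "c' \<in> charts_at F q"
      using charts_at_nonempty[OF B] charts_at_nonempty[OF F] by metis
    then show ?thesis
      by (intro bexI[of _ "product_chart c c'"]) (auto simp: product_chart_in_product_atlas charts_at_def)
  qed
  then show "(\<Union>d\<in>product_atlas B F. fst d) = UNIV" by auto
  fix d e assume "d \<in> product_atlas B F" "e \<in> product_atlas B F"
  then obtain c c' k k' where d: "d = product_chart c c'" "c \<in> B" "c' \<in> F"
    and e: "e = product_chart k k'" "k \<in> B" "k' \<in> F"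
    by (elim product_atlas_cases)
  note ch = smooth_atlasD(1)[OF B d(2)] smooth_atlasD(1)[OF F d(3)]
  let ?S = "snd c ` (fst c \<inter> fst k)" and ?T = "snd c' ` (fst c' \<inter> fst k')"
  have o: "open ?S" "open ?T"
    using open_chart_image[OF ch(1) smooth_atlasD(2)[OF B e(2)]]
      open_chart_image[OF ch(2) smooth_atlasD(2)[OF F e(3)]] by auto
  have "smooth_on ?S (snd k \<circ> chart_inv c)" "smooth_on ?T (snd k' \<circ> chart_inv c')"
    using B F d e by (auto simp: smooth_atlas_def)
  then have "smooth_on (?S \<times> ?T) (\<lambda>z. ((snd k \<circ> chart_inv c) (fst z), (snd k' \<circ> chart_inv c') (snd z)))"
    by (intro smooth_on_Pair open_Times o smooth_on_fst smooth_on_snd)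
  then have "smooth_on (?S \<times> ?T) (snd e \<circ> chart_inv d)"
    using chart_inv_product_chart[OF ch]
    by (elim smooth_on_cong[OF open_Times[OF o], rotated]) (auto simp: d(1) e(1))
  then show "smooth_on (snd d ` (fst d \<inter> fst e)) (snd e \<circ> chart_inv d)"
    by (simp add: d(1) e(1) Times_Int_Times map_prod_image_Times)
qed

section \<open>Tangent vectors and the metric on a product\<close>

context
  fixes B :: "('p::{t2_space, second_countable_topology}, 'a::euclidean_space) chart set"
    and F :: "('q::{t2_space, second_countable_topology}, 'b::euclidean_space) chart set"
  assumes B: "smooth_atlas B" and F: "smooth_atlas F"
begin

text \<open>\<open>coord_vector\<close> is 0 on functions that are not smooth near the point, so
  projecting tangent vectors requires an equivalence. For the converse direction, \<open>h\<close>
  is recovered on the slice through \<open>q\<close>, which is affine in product charts.\<close>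

lemma smooth_near_fst_iff: "smooth_near (product_atlas B F) (p, q) (h \<circ> fst) \<longleftrightarrow> smooth_near B p h"
proof
  assume "smooth_near B p h"
  then obtain W where W: "open W" "p \<in> W" "smooth_fun_on B W h" by (auto simp: smooth_near_def)
  have "smooth_fun_on (product_atlas B F) (W \<times> UNIV) (h \<circ> fst)"
    unfolding smooth_fun_on_def
  proof
    fix d assume "d \<in> product_atlas B F"
    then obtain c c' where d: "d = product_chart c c'" "c \<in> B" "c' \<in> F" by (rule product_atlas_cases)
    note ch = smooth_atlasD(1)[OF B d(2)] smooth_atlasD(1)[OF F d(3)]
    let ?S = "snd c ` (fst c \<inter> W)" and ?T = "snd c' ` fst c'"
    have o: "open ?S" "open ?T" using open_chart_image[OF ch(1) W(1)] smooth_atlasD(3)[OF F d(3)] by auto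
    have "smooth_on (?S \<times> ?T) (\<lambda>z. (h \<circ> chart_inv c) (fst z))"
      using W(3) d(2) by (intro smooth_on_fst o) (auto simp: smooth_fun_on_def o_def)
    then have "smooth_on (?S \<times> ?T) (h \<circ> fst \<circ> chart_inv d)"
      using chart_inv_product_chart[OF ch]
      by (elim smooth_on_cong[OF open_Times[OF o], rotated]) (auto simp: d(1))
    then show "smooth_on (snd d ` (fst d \<inter> W \<times> UNIV)) (h \<circ> fst \<circ> chart_inv d)"
      by (simp add: d(1) Times_Int_Times map_prod_image_Times)
  qed
  then show "smooth_near (product_atlas B F) (p, q) (h \<circ> fst)"
    unfolding smooth_near_def using W by (intro exI[of _ "W \<times> UNIV"]) (auto intro: open_Times)
next
  assume "smooth_near (product_atlas B F) (p, q) (h \<circ> fst)"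
  then obtain W where W: "open W" "(p, q) \<in> W" "smooth_fun_on (product_atlas B F) W (h \<circ> fst)"
    by (auto simp: smooth_near_def)
  \<comment> \<open>The slice of \<open>W\<close> at height \<open>q\<close>; a chart
    \<open>c'\<close> around \<open>q\<close> then embeds a chart of the base by x to (x,
    \<open>snd c' q\<close>).\<close>
  define V where "V = (\<lambda>p. (p, q)) -` W"
  have V: "open V" "p \<in> V"
    using W by (auto simp: V_def intro!: open_vimage continuous_intros)
  obtain c' where c': "c' \<in> charts_at F q" using charts_at_nonempty[OF F] .
  have "smooth_fun_on B V h"
    unfolding smooth_fun_on_def
  proof
    fix c assume c: "c \<in> B"
    note ch = smooth_atlasD(1)[OF B c] smooth_atlasD(1)[OF F charts_atD(1)[OF c']]
    let ?d = "product_chart c c'" and ?S = "snd c ` (fst c \<inter> V)"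
    have o: "open ?S" using open_chart_image[OF ch(1) V(1)] .
    have S: "(x, snd c' q) \<in> snd ?d ` (fst ?d \<inter> W)" if "x \<in> ?S" for x
      using that charts_atD(2)[OF c'] by (force simp: V_def)
    have s: "smooth_on (snd ?d ` (fst ?d \<inter> W)) (h \<circ> fst \<circ> chart_inv ?d)"
      using W(3) c charts_atD(1)[OF c'] by (auto simp: smooth_fun_on_def ball_product_atlas_iff)
    have "smooth_on ?S (\<lambda>x. (h \<circ> fst \<circ> chart_inv ?d) ((x, 0) + (0, snd c' q)))"
      by (intro smooth_on_affine_compose[OF o _ _ s] bounded_linear_Pair bounded_linear_ident bounded_linear_zero)
        (simp only: add_Pair add_0_left add_0_right S)
    then show "smooth_on ?S (h \<circ> chart_inv c)"
      using chart_inv_product_chart[OF ch] charts_atD(2)[OF c']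
      by (elim smooth_on_cong[OF o, rotated]) auto
  qed
  then show "smooth_near B p h" using V unfolding smooth_near_def by blast
qed

lemma smooth_near_snd_iff: "smooth_near (product_atlas B F) (p, q) (h \<circ> snd) \<longleftrightarrow> smooth_near F q h"
proof
  assume "smooth_near F q h"
  then obtain W where W: "open W" "q \<in> W" "smooth_fun_on F W h" by (auto simp: smooth_near_def)
  have "smooth_fun_on (product_atlas B F) (UNIV \<times> W) (h \<circ> snd)"
    unfolding smooth_fun_on_def
  proof
    fix d assume "d \<in> product_atlas B F"
    then obtain c c' where d: "d = product_chart c c'" "c \<in> B" "c' \<in> F" by (rule product_atlas_cases)
    note ch = smooth_atlasD(1)[OF B d(2)] smooth_atlasD(1)[OF F d(3)]
    let ?S = "snd c ` fst c" and ?T = "snd c' ` (fst c' \<inter> W)"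
    have o: "open ?S" "open ?T" using open_chart_image[OF ch(2) W(1)] smooth_atlasD(3)[OF B d(2)] by auto
    have "smooth_on (?S \<times> ?T) (\<lambda>z. (h \<circ> chart_inv c') (snd z))"
      using W(3) d(3) by (intro smooth_on_snd o) (auto simp: smooth_fun_on_def o_def)
    then have "smooth_on (?S \<times> ?T) (h \<circ> snd \<circ> chart_inv d)"
      using chart_inv_product_chart[OF ch]
      by (elim smooth_on_cong[OF open_Times[OF o], rotated]) (auto simp: d(1))
    then show "smooth_on (snd d ` (fst d \<inter> UNIV \<times> W)) (h \<circ> snd \<circ> chart_inv d)"
      by (simp add: d(1) Times_Int_Times map_prod_image_Times)
  qed
  then show "smooth_near (product_atlas B F) (p, q) (h \<circ> snd)"
    unfolding smooth_near_def using W by (intro exI[of _ "UNIV \<times> W"]) (auto intro: open_Times)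
next
  assume "smooth_near (product_atlas B F) (p, q) (h \<circ> snd)"
  then obtain W where W: "open W" "(p, q) \<in> W" "smooth_fun_on (product_atlas B F) W (h \<circ> snd)"
    by (auto simp: smooth_near_def)
  define V where "V = Pair p -` W"
  have V: "open V" "q \<in> V"
    using W by (auto simp: V_def intro!: open_vimage continuous_intros)
  obtain c where c: "c \<in> charts_at B p" using charts_at_nonempty[OF B] .
  have "smooth_fun_on F V h"
    unfolding smooth_fun_on_def
  proof
    fix c' assume c': "c' \<in> F"
    note ch = smooth_atlasD(1)[OF B charts_atD(1)[OF c]] smooth_atlasD(1)[OF F c']
    let ?d = "product_chart c c'" and ?S = "snd c' ` (fst c' \<inter> V)"
    have o: "open ?S" using open_chart_image[OF ch(2) V(1)] .
    have S: "(snd c p, y) \<in> snd ?d ` (fst ?d \<inter> W)" if "y \<in> ?S" for y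
      using that charts_atD(2)[OF c] by (force simp: V_def)
    have s: "smooth_on (snd ?d ` (fst ?d \<inter> W)) (h \<circ> snd \<circ> chart_inv ?d)"
      using W(3) c' charts_atD(1)[OF c] by (auto simp: smooth_fun_on_def ball_product_atlas_iff)
    have "smooth_on ?S (\<lambda>y. (h \<circ> snd \<circ> chart_inv ?d) ((0, y) + (snd c p, 0)))"
      by (intro smooth_on_affine_compose[OF o _ _ s] bounded_linear_Pair bounded_linear_ident bounded_linear_zero)
        (simp only: add_Pair add_0_left add_0_right S)
    then show "smooth_on ?S (h \<circ> chart_inv c')"
      using chart_inv_product_chart[OF ch] charts_atD(2)[OF c]
      by (elim smooth_on_cong[OF o, rotated]) auto
  qed
  then show "smooth_near F q h" using V unfolding smooth_near_def by blast
qed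

context
  fixes c c' p q
  assumes c: "c \<in> charts_at B p" and c': "c' \<in> charts_at F q"
begin

lemma product_chart_has_derivative:
  assumes "((\<lambda>z. k (chart_inv c (fst z), chart_inv c' (snd z))) has_derivative D) (at (snd c p, snd c' q))"
  shows "((\<lambda>z. k (chart_inv (product_chart c c') z)) has_derivative D) (at (snd c p, snd c' q))"
proof (rule has_derivative_transform_within_open[OF assms])
  note cA = charts_atD[OF c] charts_atD[OF c']
  show "open (snd c ` fst c \<times> snd c' ` fst c')"
    by (intro open_Times smooth_atlasD(3)[OF B cA(1)] smooth_atlasD(3)[OF F cA(3)])
  show "(snd c p, snd c' q) \<in> snd c ` fst c \<times> snd c' ` fst c'" using cA by simp
  show "k (chart_inv c (fst z), chart_inv c' (snd z)) = k (chart_inv (product_chart c c') z)"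
    if "z \<in> snd c ` fst c \<times> snd c' ` fst c'" for z
    using chart_inv_product_chart[OF smooth_atlasD(1)[OF B cA(1)] smooth_atlasD(1)[OF F cA(3)] that] by simp
qed

text \<open>In a product chart the pullback \<open>h \<circ> fst\<close> depends only on the base
  coordinates. For \<open>h\<close> not smooth near \<open>p\<close> both sides are 0 by
  \<open>smooth_near_fst_iff\<close>.\<close>

lemma tangent_map_fst:
  "tangent_map fst (coord_vector (product_atlas B F) (product_chart c c') (p, q) u)
    = coord_vector B c p (fst u)"
proof
  fix h
  have "dir_deriv (h \<circ> fst \<circ> chart_inv (product_chart c c')) (snd c p, snd c' q) u
      = dir_deriv (h \<circ> chart_inv c) (snd c p) (fst u)" if "smooth_near B p h"
  proof -
    have "((\<lambda>z. (h \<circ> fst) (chart_inv c (fst z), chart_inv c' (snd z))) has_derivative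
        (\<lambda>w. dir_deriv (h \<circ> chart_inv c) (snd c p) (fst w))) (at (snd c p, snd c' q))"
      using has_derivative_fst_compose[OF has_derivative_dir_deriv[OF smooth_near_differentiable[OF B c that]]]
      by simp
    from dir_deriv_eqI[OF product_chart_has_derivative[OF this]] show ?thesis by (simp add: o_def)
  qed
  then show "tangent_map fst (coord_vector (product_atlas B F) (product_chart c c') (p, q) u) h
      = coord_vector B c p (fst u) h"
    by (simp add: tangent_map_def coord_vector_def smooth_near_fst_iff)
qed

lemma tangent_map_snd:
  "tangent_map snd (coord_vector (product_atlas B F) (product_chart c c') (p, q) u)
    = coord_vector F c' q (snd u)"
proof
  fix h
  have "dir_deriv (h \<circ> snd \<circ> chart_inv (product_chart c c')) (snd c p, snd c' q) u
      = dir_deriv (h \<circ> chart_inv c') (snd c' q) (snd u)" if "smooth_near F q h"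
  proof -
    have "((\<lambda>z. (h \<circ> snd) (chart_inv c (fst z), chart_inv c' (snd z))) has_derivative
        (\<lambda>w. dir_deriv (h \<circ> chart_inv c') (snd c' q) (snd w))) (at (snd c p, snd c' q))"
      using has_derivative_snd_compose[OF has_derivative_dir_deriv[OF smooth_near_differentiable[OF F c' that]]]
      by simp
    from dir_deriv_eqI[OF product_chart_has_derivative[OF this]] show ?thesis by (simp add: o_def)
  qed
  then show "tangent_map snd (coord_vector (product_atlas B F) (product_chart c c') (p, q) u) h
      = coord_vector F c' q (snd u) h"
    by (simp add: tangent_map_def coord_vector_def smooth_near_snd_iff)
qed

end

lemma local_metric_product:
  assumes "c \<in> B" "c' \<in> F" "z \<in> snd c ` fst c \<times> snd c' ` fst c'"
  shows "local_metric (product_atlas B F) (warped_metric gB f gF) (product_chart c c') z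
    = warped_form (local_metric B gB c (fst z)) ((f \<circ> chart_inv c) (fst z)) (local_metric F gF c' (snd z))"
proof (intro ext)
  fix u v
  have z: "fst z \<in> snd c ` fst c" "snd z \<in> snd c' ` fst c'" using assms(3) by auto
  note tm = tangent_map_fst[OF charts_at_chart_inv[OF assms(1) z(1)] charts_at_chart_inv[OF assms(2) z(2)]]
    tangent_map_snd[OF charts_at_chart_inv[OF assms(1) z(1)] charts_at_chart_inv[OF assms(2) z(2)]]
  show "local_metric (product_atlas B F) (warped_metric gB f gF) (product_chart c c') z u v
    = warped_form (local_metric B gB c (fst z)) ((f \<circ> chart_inv c) (fst z)) (local_metric F gF c' (snd z)) u v"
    unfolding local_metric_def warped_metric_def warped_form_def
      chart_inv_product_chart[OF smooth_atlasD(1)[OF B assms(1)] smooth_atlasD(1)[OF F assms(2)] assms(3)] tm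
    by simp
qed

end

section \<open>The Einstein equation of the warped product in product charts\<close>

lemma christoffel_cong_open:
  assumes "open S" "x \<in> S" "\<And>y. y \<in> S \<Longrightarrow> G y = G' y"
  shows "christoffel G x u v = christoffel G' x u v"
proof -
  have "dir_deriv (\<lambda>y. G y u v) x = dir_deriv (\<lambda>y. G' y u v) x" for u v
    by (rule dir_deriv_cong_open[OF assms(1) _ assms(2)]) (simp add: assms(3))
  then show ?thesis unfolding christoffel_def assms(3)[OF assms(2)] by simp
qed

text \<open>Ricci curvature is local in the metric. This is what permits replacing
  \<open>local_metric\<close> of the product by \<open>warped_form\<close>, with which it coincides
  on the chart image.\<close>

lemma local_ricci_cong_open:
  assumes "open S" "x \<in> S" "\<And>y. y \<in> S \<Longrightarrow> G y = G' y"
  shows "local_ricci G x u v = local_ricci G' x u v"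
proof -
  have "christoffel G y u v = christoffel G' y u v" if "y \<in> S" for y u v
    by (rule christoffel_cong_open[OF assms(1) that assms(3)])
  moreover from this have "dir_deriv (\<lambda>y. christoffel G y u v) x = dir_deriv (\<lambda>y. christoffel G' y u v) x" for u v
    by (intro dir_deriv_cong_open[OF assms(1) _ assms(2)])
  ultimately show ?thesis
    unfolding local_ricci_def local_curvature_def using assms(2) by simp
qed

lemma scalar_product_chart:
  assumes "semi_riemannian A g" "c \<in> A" "x \<in> snd c ` fst c"
  shows "scalar_product (local_metric A g c x)"
  using assms unfolding semi_riemannian_def by blast

context
  fixes B :: "('p::{t2_space, second_countable_topology}, 'a::euclidean_space) chart set"
    and F :: "('q::{t2_space, second_countable_topology}, 'b::euclidean_space) chart set"
    and gB gF and f :: "'p \<Rightarrow> real"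
  assumes gB: "semi_riemannian B gB" and gF: "semi_riemannian F gF"
    and f: "smooth_fun_on B UNIV f" and f_pos: "\<And>p. f p > 0"
begin

lemma atlases: "smooth_atlas B" "smooth_atlas F"
  using gB gF by (auto simp: semi_riemannian_def)

lemma local_warped_product_chart:
  assumes "c \<in> B" "c' \<in> F"
  shows "local_warped_product (snd c ` fst c) (local_metric B gB c) (f \<circ> chart_inv c)
    (snd c' ` fst c') (local_metric F gF c')"
  using f_pos
  by (intro local_warped_product.intro local_scalar_field_chart[OF gB assms(1) f]
      local_semi_riemannian_chart[OF gF assms(2)] local_warped_product_axioms.intro) simp

lemma semi_riemannian_warped: "semi_riemannian (product_atlas B F) (warped_metric gB f gF)"
proof -
  let ?g = "local_metric (product_atlas B F) (warped_metric gB f gF)"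
  have charts: "open (snd c ` fst c \<times> snd c' ` fst c')" if "c \<in> B" "c' \<in> F" for c c'
    using that by (intro open_Times smooth_atlasD[OF atlases(1)] smooth_atlasD[OF atlases(2)])
  obtain \<nu> \<nu>' where \<nu>: "\<And>c x. c \<in> B \<Longrightarrow> x \<in> snd c ` fst c \<Longrightarrow> form_index (local_metric B gB c x) = \<nu>"
    "\<And>c x. c \<in> F \<Longrightarrow> x \<in> snd c ` fst c \<Longrightarrow> form_index (local_metric F gF c x) = \<nu>'"
    using gB gF unfolding semi_riemannian_def by metis
  have eq: "?g (product_chart c c') z
      = warped_form (local_metric B gB c (fst z)) ((f \<circ> chart_inv c) (fst z)) (local_metric F gF c' (snd z))"
    if "c \<in> B" "c' \<in> F" "z \<in> snd c ` fst c \<times> snd c' ` fst c'" for c c' z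
    by (rule local_metric_product[OF atlases that])
  have "smooth_on (snd c ` fst c \<times> snd c' ` fst c') (\<lambda>z. ?g (product_chart c c') z u v)"
    if c: "c \<in> B" "c' \<in> F" for c c' u v
  proof -
    interpret local_warped_product "snd c ` fst c" "local_metric B gB c" "f \<circ> chart_inv c"
      "snd c' ` fst c'" "local_metric F gF c'"
      by (rule local_warped_product_chart[OF c])
    show ?thesis
      using W.smooth_G[of u v] by (rule smooth_on_cong[OF charts[OF c], rotated]) (simp add: eq[OF c])
  qed
  moreover have "scalar_product (?g (product_chart c c') z)"
      "form_index (?g (product_chart c c') z) = \<nu> + \<nu>'"
    if c: "c \<in> B" "c' \<in> F" and z: "z \<in> snd c ` fst c \<times> snd c' ` fst c'" for c c' z
  proof -
    have z': "fst z \<in> snd c ` fst c" "snd z \<in> snd c' ` fst c'" using z by auto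
    have ne: "(f \<circ> chart_inv c) (fst z) \<noteq> 0" using f_pos[of "chart_inv c (fst z)"] by simp
    note sp = scalar_product_chart[OF gB c(1) z'(1)] scalar_product_chart[OF gF c(2) z'(2)]
    show "scalar_product (?g (product_chart c c') z)"
      unfolding eq[OF c z] by (rule scalar_product_warped_form[OF sp ne])
    show "form_index (?g (product_chart c c') z) = \<nu> + \<nu>'"
      unfolding eq[OF c z] form_index_warped_form[OF sp ne] using \<nu> c z' by simp
  qed
  ultimately show ?thesis
    unfolding semi_riemannian_def ball_product_atlas_iff fst_product_chart snd_product_chart map_prod_image_Times
    using smooth_atlas_product[OF atlases] by blast
qed

text \<open>The base and fiber coordinates are quantified separately, ready for the pointwise
  criterion \<open>local_ricci_GW_eq_iff\<close>.\<close>

lemma einstein_warped_iff_local: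
  "einstein (product_atlas B F) (warped_metric gB f gF) \<mu> \<longleftrightarrow>
    (\<forall>c\<in>B. \<forall>c'\<in>F. \<forall>x\<in>snd c ` fst c. \<forall>y\<in>snd c' ` fst c'. \<forall>u v.
      local_ricci (\<lambda>z. warped_form (local_metric B gB c (fst z)) ((f \<circ> chart_inv c) (fst z)) (local_metric F gF c' (snd z)))
        (x, y) u v
      = \<mu> * warped_form (local_metric B gB c x) (f (chart_inv c x)) (local_metric F gF c' y) u v)"
proof -
  let ?g = "local_metric (product_atlas B F) (warped_metric gB f gF)"
  let ?G = "\<lambda>c c' z. warped_form (local_metric B gB c (fst z)) ((f \<circ> chart_inv c) (fst z)) (local_metric F gF c' (snd z))"
  have "local_ricci (?g (product_chart c c')) (x, y) u v = local_ricci (?G c c') (x, y) u v"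
    "?g (product_chart c c') (x, y) = ?G c c' (x, y)"
    if c: "c \<in> B" "c' \<in> F" and x: "x \<in> snd c ` fst c" "y \<in> snd c' ` fst c'" for c c' x y u v
  proof -
    have eq: "?g (product_chart c c') z = ?G c c' z" if "z \<in> snd c ` fst c \<times> snd c' ` fst c'" for z
      by (rule local_metric_product[OF atlases c that])
    have "open (snd c ` fst c \<times> snd c' ` fst c')"
      using c by (intro open_Times smooth_atlasD[OF atlases(1)] smooth_atlasD[OF atlases(2)])
    then show "local_ricci (?g (product_chart c c')) (x, y) u v = local_ricci (?G c c') (x, y) u v"
      by (rule local_ricci_cong_open[OF _ _ eq]) (use x in auto)
    show "?g (product_chart c c') (x, y) = ?G c c' (x, y)" using eq x by simp
  qed
  note * = this
  have Times: "(\<forall>z\<in>S \<times> T. P z) \<longleftrightarrow> (\<forall>x\<in>S. \<forall>y\<in>T. P (x, y))" for S :: "'a set" and T :: "'b set" and P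
    by blast
  show ?thesis
    unfolding einstein_iff_local ball_product_atlas_iff fst_product_chart snd_product_chart
      map_prod_image_Times Times
    using semi_riemannian_warped by (simp only: * simp_thms o_apply fst_conv snd_conv cong: ball_cong)
qed

end

section \<open>Global consequences of the Hessian equation on the base\<close>

lemma gradient_norm_constant:
  assumes gB: "semi_riemannian (B :: ('p::{t2_space, second_countable_topology}, 'a::euclidean_space) chart set) gB"
    and f: "smooth_fun_on B UNIV f" and conn: "connected (UNIV :: 'p set)"
    and hess: "\<And>c x u v. c \<in> B \<Longrightarrow> x \<in> snd c ` fst c \<Longrightarrow>
      local_hessian (local_metric B gB c) (f \<circ> chart_inv c) x u v
        = k * (f \<circ> chart_inv c) x * local_metric B gB c x u v"
  obtains a where "\<And>p. gB p (gradient B gB f p) (gradient B gB f p) = k * (f p)\<^sup>2 + a"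
proof -
  have atlas: "smooth_atlas B" using gB by (simp add: semi_riemannian_def)
  define h where "h p = gB p (gradient B gB f p) (gradient B gB f p) - k * (f p)\<^sup>2" for p
  have "h constant_on UNIV"
  proof (rule constant_if_derivative_zero[OF atlas conn])
    fix c x assume c: "c \<in> B" and x: "x \<in> snd c ` fst c"
    interpret local_scalar_field "snd c ` fst c" "local_metric B gB c" "f \<circ> chart_inv c"
      by (rule local_scalar_field_chart[OF gB c f])
    have "(h \<circ> chart_inv c) y = local_metric B gB c y (grad y) (grad y) - k * ((f \<circ> chart_inv c) y)\<^sup>2"
      if y: "y \<in> snd c ` fst c" for y
      unfolding h_def o_apply metric_gradient_chart[OF gB charts_at_chart_inv[OF c y] f] chart_chart_inv[OF y]
      by (simp add: o_def)
    then show "((h \<circ> chart_inv c) has_derivative (\<lambda>_. 0)) (at x)"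
      by (intro has_derivative_transform_within_open[OF has_derivative_grad_norm[OF hess[OF c] x] open_S x]) auto
  qed
  then obtain a where "\<And>p. h p = a" unfolding constant_on_def by auto
  then show ?thesis using that[of a] unfolding h_def by (metis diff_add_cancel add.commute)
qed

text \<open>At a point where df is nonzero, Ric(u, grad f) is computed twice: from the Einstein
  condition and from the curvature identity for the gradient. Choosing \<open>u\<close> with df(u)
  nonzero permits cancelling.\<close>

lemma ricci_of_hessian_equation:
  assumes e: "einstein (B :: ('p::{t2_space, second_countable_topology}, 'a::euclidean_space) chart set) gB lamB"
    and f: "smooth_fun_on B UNIV f" and conn: "connected (UNIV :: 'p set)"
    and hess: "\<And>c x u v. c \<in> B \<Longrightarrow> x \<in> snd c ` fst c \<Longrightarrow>
      local_hessian (local_metric B gB c) (f \<circ> chart_inv c) x u v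
        = k * (f \<circ> chart_inv c) x * local_metric B gB c x u v"
    and nonconst: "\<not> f constant_on UNIV"
  shows "lamB = - ((real DIM('a) - 1) * k)"
proof -
  have gB: "semi_riemannian B gB" using e by (simp add: einstein_def)
  then have atlas: "smooth_atlas B" by (simp add: semi_riemannian_def)
  obtain c x where c: "c \<in> B" and x: "x \<in> snd c ` fst c"
    and ne: "\<not> ((f \<circ> chart_inv c) has_derivative (\<lambda>_. 0)) (at x)"
    using constant_if_derivative_zero[OF atlas conn] nonconst by blast
  interpret local_scalar_field "snd c ` fst c" "local_metric B gB c" "f \<circ> chart_inv c"
    by (rule local_scalar_field_chart[OF gB c f])
  obtain u where u: "dir_deriv (f \<circ> chart_inv c) x u \<noteq> 0"
    using ne smooth_on_has_derivative[OF smooth_\<phi> x] by (metis ext)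
  have "lamB * dir_deriv (f \<circ> chart_inv c) x u = lamB * local_metric B gB c x u (grad x)"
    unfolding G_commute[OF x, of u] G_grad[OF x] ..
  also have "\<dots> = local_ricci (local_metric B gB c) x u (grad x)"
    using e c x unfolding einstein_iff_local by metis
  also have "\<dots> = - ((real DIM('a) - 1) * k) * dir_deriv (f \<circ> chart_inv c) x u"
    using local_ricci_grad[OF hess[OF c] x] by simp
  finally show ?thesis using u by (metis mult_right_cancel)
qed

theorem theorem2p1:
  fixes B :: "('p::{t2_space, second_countable_topology}, 'a::euclidean_space) chart set"
    and F :: "('q::{t2_space, second_countable_topology}, 'b::euclidean_space) chart set"
    and gB :: "'p metric" and gF :: "'q metric"
    and f :: "'p \<Rightarrow> real"
    and lamB lamF lam :: real
  assumes "DIM('a) \<ge> 3"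
    and "connected (UNIV :: 'p set)"
    and "einstein B gB lamB"
    and "einstein F gF lamF"
    and "smooth_fun_on B UNIV f"
    and "\<And>p. f p > 0"
    and "\<not> f constant_on UNIV"
  shows "einstein (product_atlas B F) (warped_metric gB f gF) lam \<longleftrightarrow>
    (\<forall>p. \<forall>c\<in>charts_at B p. \<forall>X\<in>tangent_space B p. \<forall>Y\<in>tangent_space B p.
       hessian B gB f c p X Y = f p / real DIM('b) * (lamB - lam) * gB p X Y) \<and>
    lam = (1 + real DIM('b) / (real DIM('a) - 1)) * lamB \<and>
    (\<exists>k. (\<forall>p. \<forall>c\<in>charts_at B p.
            gB p (gradient B gB f p) (gradient B gB f p)
              = - normalized_scalar_curvature B gB c p * (f p)\<^sup>2 + k) \<and>
         lamF = (real DIM('b) - 1) * k)"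
    (is "?E \<longleftrightarrow> ?i \<and> ?ii \<and> ?iii")
proof -
  define n where "n = real DIM('a)"
  define d where "d = real DIM('b)"
  \<comment> \<open>The coefficient in the Hessian equation Hess f = k f g that makes the base block
    of the Ricci tensor equal to \<open>lam\<close> times the metric.\<close>
  define k where "k = (lamB - lam) / d"
  define Q where "Q p = gB p (gradient B gB f p) (gradient B gB f p)" for p
  have n: "n - 1 > 0" and d: "d > 0" using assms(1) by (simp_all add: n_def d_def)
  have lam: "lam = lamB - d * k" using d by (simp add: k_def)
  have gB: "semi_riemannian B gB" and gF: "semi_riemannian F gF"
    using assms(3,4) by (auto simp: einstein_def)
  then have atlas: "smooth_atlas B" "smooth_atlas F" by (auto simp: semi_riemannian_def)
  define H where "H \<longleftrightarrow> (\<forall>c\<in>B. \<forall>x\<in>snd c ` fst c. \<forall>u v.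
    local_hessian (local_metric B gB c) (f \<circ> chart_inv c) x u v
      = k * (f \<circ> chart_inv c) x * local_metric B gB c x u v)"
  have i: "?i \<longleftrightarrow> H"
    unfolding hessian_eq_iff_local[OF atlas(1), of gB f "\<lambda>p. f p / real DIM('b) * (lamB - lam)"] H_def
    by (simp add: k_def d_def mult.commute)
  have E: "?E \<longleftrightarrow> H \<and> (\<forall>p. lamF = (lam + n * k) * (f p)\<^sup>2 + (d - 1) * Q p)"
  proof -
    let ?P = "\<lambda>c x. (\<forall>u v. local_hessian (local_metric B gB c) (f \<circ> chart_inv c) x u v
        = k * (f \<circ> chart_inv c) x * local_metric B gB c x u v) \<and>
      lamF = (lam + n * k) * (f (chart_inv c x))\<^sup>2 + (d - 1) * Q (chart_inv c x)"
    have pt: "(\<forall>u v. local_ricci (\<lambda>z. warped_form (local_metric B gB c (fst z)) ((f \<circ> chart_inv c) (fst z)) (local_metric F gF c' (snd z)))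
        (x, y) u v
      = lam * warped_form (local_metric B gB c x) (f (chart_inv c x)) (local_metric F gF c' y) u v) \<longleftrightarrow> ?P c x"
      if c: "c \<in> B" "c' \<in> F" and x: "x \<in> snd c ` fst c" and y: "y \<in> snd c' ` fst c'" for c c' x y
    proof -
      interpret local_warped_product "snd c ` fst c" "local_metric B gB c" "f \<circ> chart_inv c"
        "snd c' ` fst c'" "local_metric F gF c'"
        by (rule local_warped_product_chart[OF gB gF assms(5,6) c])
      have RB: "local_ricci (local_metric B gB c) x u v = lamB * local_metric B gB c x u v" for u v
        using assms(3) c(1) x unfolding einstein_iff_local by blast
      have RF: "local_ricci (local_metric F gF c') y u v = lamF * local_metric F gF c' y u v" for u v
        using assms(4) c(2) y unfolding einstein_iff_local by blast
      have Q: "Q (chart_inv c x) = local_metric B gB c x (B.grad x) (B.grad x)"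
        unfolding Q_def metric_gradient_chart[OF gB charts_at_chart_inv[OF c(1) x] assms(5)] chart_chart_inv[OF x] ..
      show ?thesis
        using local_ricci_GW_eq_iff[OF x y RB RF, of k lam] unfolding Q by (simp add: k_def n_def d_def)
    qed
    \<comment> \<open>\<open>?P\<close> speaks of the base alone; one point of the fiber suffices to
      discard the quantifiers over \<open>c'\<close> and \<open>y\<close>.\<close>
    obtain c' y where "c' \<in> F" "y \<in> snd c' ` fst c'"
      using charts_at_nonempty[OF atlas(2)] charts_atD by (metis imageI)
    then have drop: "(\<forall>c\<in>B. \<forall>c'\<in>F. \<forall>x\<in>snd c ` fst c. \<forall>y\<in>snd c' ` fst c'. R c x) \<longleftrightarrow>
        (\<forall>c\<in>B. \<forall>x\<in>snd c ` fst c. R c x)" for R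
      by blast
    have "?E \<longleftrightarrow> (\<forall>c\<in>B. \<forall>c'\<in>F. \<forall>x\<in>snd c ` fst c. \<forall>y\<in>snd c' ` fst c'. ?P c x)"
      unfolding einstein_warped_iff_local[OF gB gF assms(5,6)] by (intro ball_cong refl pt)
    also have "\<dots> \<longleftrightarrow> (\<forall>c\<in>B. \<forall>x\<in>snd c ` fst c. ?P c x)" by (rule drop)
    also have "\<dots> \<longleftrightarrow> H \<and> (\<forall>p. \<forall>c\<in>charts_at B p. lamF = (lam + n * k) * (f p)\<^sup>2 + (d - 1) * Q p)"
      unfolding H_def ball_charts_at_iff[OF atlas(1)] by blast
    also have "\<dots> \<longleftrightarrow> H \<and> (\<forall>p. lamF = (lam + n * k) * (f p)\<^sup>2 + (d - 1) * Q p)"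
      using charts_at_nonempty[OF atlas(1)] by metis
    finally show ?thesis .
  qed
  have \<rho>: "normalized_scalar_curvature B gB c p = lamB / (n - 1)" if "c \<in> charts_at B p" for c p
    using n unfolding normalized_scalar_curvature_def scalar_curvature_einstein[OF assms(3) that]
    by (simp add: n_def)
  have iii: "?iii \<longleftrightarrow> (\<exists>a. (\<forall>p. Q p = - (lamB / (n - 1)) * (f p)\<^sup>2 + a) \<and> lamF = (d - 1) * a)"
  proof -
    have "(\<forall>p. \<forall>c\<in>charts_at B p. Q p = - normalized_scalar_curvature B gB c p * (f p)\<^sup>2 + a)
      \<longleftrightarrow> (\<forall>p. Q p = - (lamB / (n - 1)) * (f p)\<^sup>2 + a)" for a
      using \<rho> charts_at_nonempty[OF atlas(1)] by metis
    then show ?thesis unfolding Q_def d_def by simp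
  qed
  \<comment> \<open>The first equation is the coefficient of f^2 in the fiber equation after |grad
    f|^2 = k f^2 + a is inserted; the second identifies -k with the normalized scalar
    curvature.\<close>
  have coeff: "lam + n * k + (d - 1) * k = 0" "k = - (lamB / (n - 1))" if "lamB = - ((n - 1) * k)"
    using that n by (simp_all add: lam field_simps)
  show ?thesis
  proof
    assume ?E
    then have H: H and q: "\<And>p. lamF = (lam + n * k) * (f p)\<^sup>2 + (d - 1) * Q p" using E by auto
    have lamB: "lamB = - ((n - 1) * k)"
      using ricci_of_hessian_equation[OF assms(3,5,2) _ assms(7), of k] H unfolding H_def n_def by blast
    obtain a where a: "\<And>p. Q p = k * (f p)\<^sup>2 + a"
      using gradient_norm_constant[OF gB assms(5,2), of k] H unfolding H_def Q_def by blast
    have "lamF = (lam + n * k + (d - 1) * k) * (f p)\<^sup>2 + (d - 1) * a" for p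
      using q[of p] unfolding a by (simp add: algebra_simps)
    then have "lamF = (d - 1) * a" unfolding coeff(1)[OF lamB] by simp
    moreover have "?ii"
      unfolding lam coeff(2)[OF lamB] by (simp add: n_def d_def algebra_simps)
    ultimately show "?i \<and> ?ii \<and> ?iii"
      unfolding i iii using H a coeff(2)[OF lamB] by auto
  next
    assume c: "?i \<and> ?ii \<and> ?iii"
    then obtain a where a: "\<And>p. Q p = - (lamB / (n - 1)) * (f p)\<^sup>2 + a" "lamF = (d - 1) * a"
      unfolding iii by blast
    \<comment> \<open>Comparing (ii) with \<open>lam = lamB - d * k\<close> recovers the trace
      identity, so the coefficient of f^2 vanishes in this direction too.\<close>
    have "d * (lamB / (n - 1)) = d * - k"
      using c lam by (simp add: n_def d_def algebra_simps)
    then have "lamB / (n - 1) = - k" using d by (metis mult_left_cancel less_irrefl)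
    then have lamB: "lamB = - ((n - 1) * k)" using n by (simp add: field_simps)
    have "lamF = (lam + n * k) * (f p)\<^sup>2 + (d - 1) * Q p" for p
    proof -
      have "(lam + n * k) * (f p)\<^sup>2 + (d - 1) * Q p = (lam + n * k + (d - 1) * k) * (f p)\<^sup>2 + (d - 1) * a"
        unfolding a(1) coeff(2)[OF lamB, symmetric] by (simp add: algebra_simps)
      then show ?thesis unfolding coeff(1)[OF lamB] using a(2) by simp
    qed
    then show ?E using E c i by blast
  qed
qed

end
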